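(* For every positive integer $n$ and every graph $G$ on $n$ vertices, \[ \operatorname{obs}_c(G) \leq (n-1)\bigl(\lceil\log_2 \chi_s(G)\rceil + 1\bigr). \]
   Context: A geometric drawing of a graph represents its vertices by distinct points in the plane and each edge by the line segment between its endpoints. An obstacle is a polygon in the plane. An obstacle representation of a graph $G$ is a geometric drawing of $G$ together with a set $\mathcal{O}$ of obstacles such that two vertices of $G$ are adjacent if and only if the line segment between the corresponding points is disjoint from all obstacles in $\mathcal{O}$. The convex obstacle number $\operatorname{obs}_c(G)$ is the minimum number of obstacles in an obstacle representation of $G$ in which all obstacles are convex. A subcoloring of $G=(V,E)$ is a map $c\colon V\to\{1,\dots,k\}$ such that each color class $c^{-1}(a)$ induces a disjoint union of cliques in $G$; the subchromatic number $\chi_s(G)$ is the least $k$ for which a subcoloring of $G$ with $k$ colors exists. *)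

theory Defs
  imports "HOL-Analysis.Analysis" "HOL-Library.Disjoint_Sets"
begin

definition all_pairs :: "'a set \<Rightarrow> 'a set set" where
  "all_pairs A = {e. e \<subseteq> A \<and> card e = 2}"

definition simple_graph :: "'a set \<Rightarrow> 'a set set \<Rightarrow> bool" where
  "simple_graph V E \<longleftrightarrow> finite V \<and> E \<subseteq> all_pairs V"

definition induced_edges :: "'a set set \<Rightarrow> 'a set \<Rightarrow> 'a set set" where
  "induced_edges E A = {e \<in> E. e \<subseteq> A}"


text \<open>Polygons are closed regions: a simple closed curve made up of finitely many segments,
  together with its interior.\<close>

definition polygon :: "(real ^ 2) set \<Rightarrow> bool" where
  "polygon P \<longleftrightarrow>
     (\<exists>g F. simple_path g \<and> pathfinish g = pathstart g \<and>
            finite F \<and> path_image g = (\<Union>(a, b)\<in>F. closed_segment a b) \<and>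
            P = path_image g \<union> inside (path_image g))"

text \<open>In a geometric drawing the edges are determined by the positions of the vertices.\<close>

definition geometric_drawing :: "'a set \<Rightarrow> ('a \<Rightarrow> real ^ 2) \<Rightarrow> bool" where
  "geometric_drawing V p \<longleftrightarrow> inj_on p V"

definition obstacle_representation ::
    "'a set \<Rightarrow> 'a set set \<Rightarrow> ('a \<Rightarrow> real ^ 2) \<Rightarrow> (real ^ 2) set set \<Rightarrow> bool" where
  "obstacle_representation V E p Obs \<longleftrightarrow>
     geometric_drawing V p \<and> (\<forall>P\<in>Obs. polygon P) \<and>
     (\<forall>u\<in>V. \<forall>v\<in>V. u \<noteq> v \<longrightarrow>
        ({u, v} \<in> E \<longleftrightarrow> (\<forall>P\<in>Obs. closed_segment (p u) (p v) \<inter> P = {})))"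

definition convex_obstacle_number :: "'a set \<Rightarrow> 'a set set \<Rightarrow> nat" where
  "convex_obstacle_number V E =
     (LEAST k. \<exists>p Obs. obstacle_representation V E p Obs \<and> (\<forall>P\<in>Obs. convex P) \<and>
                        finite Obs \<and> card Obs = k)"


definition induces_disjoint_cliques :: "'a set set \<Rightarrow> 'a set \<Rightarrow> bool" where
  "induces_disjoint_cliques E A \<longleftrightarrow>
     (\<exists>\<C>. partition_on A \<C> \<and> induced_edges E A = (\<Union>C\<in>\<C>. all_pairs C))"

definition subcoloring :: "'a set \<Rightarrow> 'a set set \<Rightarrow> nat \<Rightarrow> ('a \<Rightarrow> nat) \<Rightarrow> bool" where
  "subcoloring V E k c \<longleftrightarrow>
     c ` V \<subseteq> {1..k} \<and> (\<forall>a\<in>{1..k}. induces_disjoint_cliques E {v \<in> V. c v = a})"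

definition subchromatic_number :: "'a set \<Rightarrow> 'a set set \<Rightarrow> nat" where
  "subchromatic_number V E = (LEAST k. \<exists>c. subcoloring V E k c)"

end

theory Submission
  imports Defs "HOL-Complex_Analysis.Contour_Integration"
begin

text \<open>
  Sort the vertices by colour and, within a colour, by clique, and place the \<open>i\<close>-th vertex at height
  \<open>N i + i\<^sup>2\<close> for a large \<open>N\<close>, all on one vertical line. Colours are separated bit by bit: in each of
  \<open>\<lceil>log\<^sub>2 \<chi>\<^sub>s\<rceil>\<close> rounds every cluster (the vertices still on a common vertical line) is split into a
  lower and an upper part, and the upper part is shifted to the right by a tiny \<open>\<epsilon>\<close>. Among the segments
  joining the two parts, those with the same index sum \<open>i + j\<close> are tangent to one parabola, so the
  convex hull of the points of tangency of the non-edges meets exactly these non-edges; the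
  quadratic term of the heights also keeps it away from the segments leaving the cluster. A cluster
  with \<open>m\<close> vertices has at most \<open>m - 1\<close> relevant index sums, hence a round needs at most \<open>n - 1\<close>
  obstacles. After slight thickening of the obstacles, all requirements are open conditions and
  survive the later shifts. Finally, a small obstacle between consecutive cliques of each colour
  class blocks the remaining non-edges, again with at most \<open>n - 1\<close> obstacles.
\<close>

section \<open>Polygons and perturbed segments\<close>

text \<open>The frontiers of full-dimensional compact convex sets in the plane are all homeomorphic
  to a circle, which yields the simple closed curve. The facets of \<open>P\<close> are compact,
  convex and one-dimensional, so they are segments, and the inside of the frontier of a bounded
  convex set is its interior.\<close>

lemma polygon_polytope:
  fixes P :: "(real ^ 2) set"
  assumes "polytope P" "interior P \<noteq> {}"
  shows "polygon P"
proof -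
  have P: "compact P" "convex P" "polyhedron P"
    using assms polytope_imp_compact polytope_imp_convex polytope_imp_polyhedron by auto
  have dimP: "aff_dim P = 2"
    using aff_dim_nonempty_interior[OF assms(2)] by simp
  have frontier: "rel_frontier P = frontier P"
    using assms(2) by (simp add: rel_frontier_nonempty_interior)
  have "rel_frontier (cball (0::complex) 1) homeomorphic rel_frontier P"
    using P dimP
    by (intro homeomorphic_rel_frontiers_convex_bounded_sets)
       (auto simp: compact_imp_bounded aff_dim_cball)
  then obtain h h' where h: "homeomorphism (sphere (0::complex) 1) (frontier P) h h'"
    unfolding homeomorphic_def frontier by (auto simp: rel_frontier_nonempty_interior)
  define g where "g = h \<circ> circlepath 0 1"
  have "simple_path g"
    unfolding g_def
  proof (rule simple_path_continuous_image)
    show "inj_on h (path_image (circlepath 0 1))"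
      using h by (auto simp: homeomorphism_def intro: inj_on_inverseI)
  qed (use h in \<open>auto simp: simple_path_circlepath homeomorphism_def\<close>)
  moreover have "pathfinish g = pathstart g"
    by (simp add: g_def pathfinish_compose pathstart_compose)
  moreover have img: "path_image g = frontier P"
    using h by (simp add: g_def path_image_compose homeomorphism_def)
  moreover have "\<exists>F. finite F \<and> path_image g = (\<Union>(a, b)\<in>F. closed_segment a b)"
  proof -
    have "\<exists>a b. S = closed_segment a b" if "S facet_of P" for S
    proof -
      have S: "S face_of P" "S \<noteq> {}" "aff_dim S = 1"
        using that dimP by (auto simp: facet_of_def)
      then have "compact S" "convex S"
        using assms(1) face_of_polytope_polytope polytope_imp_compact face_of_imp_convex by blast+
      then show ?thesis
        using S compact_convex_collinear_segment[of S] collinear_aff_dim[of S] by (metis order_refl)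
    qed
    then obtain a b where ab: "\<And>S. S facet_of P \<Longrightarrow> S = closed_segment (a S) (b S)"
      by metis
    define F where "F = (\<lambda>S. (a S, b S)) ` {S. S facet_of P}"
    have "finite F"
      unfolding F_def using finite_polyhedron_facets[OF P(3)] by simp
    moreover have "path_image g = (\<Union>(a, b)\<in>F. closed_segment a b)"
    proof -
      have "(\<Union>(a, b)\<in>F. closed_segment a b) = (\<Union>S\<in>{S. S facet_of P}. closed_segment (a S) (b S))"
        by (simp add: F_def)
      also have "\<dots> = (\<Union>S\<in>{S. S facet_of P}. S)"
        using ab by (intro SUP_cong) auto
      finally show ?thesis
        using img frontier rel_frontier_of_polyhedron[OF P(3)] by simp
    qed
    ultimately show ?thesis by blast
  qed
  moreover have "P = path_image g \<union> inside (path_image g)"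
    unfolding img
    using interior_subset[of P] compact_imp_closed[OF P(1)]
      inside_frontier_eq_interior[OF compact_imp_bounded[OF P(1)] P(2)]
    by (auto simp: frontier_def)
  ultimately show ?thesis unfolding polygon_def by blast
qed

text \<open>\<open>P\<close> is the Minkowski sum of the hull with a small box around the origin:
  the linear image of a product polytope under addition. It turns hulls that may be single points or
  segments into sets with nonempty interior.\<close>

lemma polytope_thickening:
  fixes K :: "(real ^ 2) set"
  assumes "finite K" "K \<noteq> {}" "\<rho> > 0"
  obtains P where "polytope P" "convex hull K \<subseteq> interior P"
    "\<And>w. w \<in> P \<Longrightarrow> \<exists>z\<in>convex hull K. dist z w \<le> \<rho>"
proof -
  obtain a b :: "real ^ 2" where ab: "0 \<in> box a b" "cbox a b \<subseteq> ball 0 \<rho>"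
    using assms(3) by (rule_tac open_contains_cbox[of "ball 0 \<rho>" "0 :: real ^ 2"]) auto
  define P where "P = (\<lambda>(x, y). x + y) ` ((convex hull K) \<times> cbox a b)"
  have "polytope P"
    unfolding P_def
  proof (rule polytope_linear_image)
    show "linear (\<lambda>(x :: real ^ 2, y). x + y)"
      by (auto simp: linear_iff scaleR_add_right)
    show "polytope ((convex hull K) \<times> cbox a b)"
      by (intro polytope_Times[OF polytope_convex_hull polytope_interval] assms(1))
  qed
  moreover have "convex hull K \<subseteq> interior P"
  proof
    fix z assume z: "z \<in> convex hull K"
    have "(+) z ` box a b \<subseteq> P"
      unfolding P_def using z box_subset_cbox[of a b] by force
    moreover have "open ((+) z ` box a b)" by (intro open_translation open_box)
    moreover have "z \<in> (+) z ` box a b" using image_eqI[of z "(+) z" 0] ab(1) by simp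
    ultimately show "z \<in> interior P" by (meson interiorI)
  qed
  moreover have "\<exists>z\<in>convex hull K. dist z w \<le> \<rho>" if w: "w \<in> P" for w
  proof -
    obtain z y where "z \<in> convex hull K" "y \<in> cbox a b" "w = z + y"
      using w by (auto simp: P_def)
    then show ?thesis using ab(2) by (intro bexI[of _ z]) (auto simp: dist_norm)
  qed
  ultimately show ?thesis using that by blast
qed

section \<open>Stability of segments under small displacements of their endpoints\<close>

text \<open>The point with the same affine parameter works: its displacement is a convex combination
  of the displacements of the endpoints.\<close>

lemma closed_segment_perturb:
  fixes a b a' b' :: "'a :: real_normed_vector"
  assumes "dist a' a \<le> \<rho>" "dist b' b \<le> \<rho>" "z \<in> closed_segment a b"
  shows "\<exists>z'\<in>closed_segment a' b'. dist z' z \<le> \<rho>"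
proof -
  obtain u where u: "0 \<le> u" "u \<le> 1" "z = (1 - u) *\<^sub>R a + u *\<^sub>R b"
    using assms(3) by (auto simp: in_segment)
  have "(1 - u) *\<^sub>R a' + u *\<^sub>R b' - z = (1 - u) *\<^sub>R (a' - a) + u *\<^sub>R (b' - b)"
    by (simp add: u algebra_simps)
  then have "dist ((1 - u) *\<^sub>R a' + u *\<^sub>R b') z \<le> (1 - u) * dist a' a + u * dist b' b"
    using u norm_triangle_ineq[of "(1 - u) *\<^sub>R (a' - a)" "u *\<^sub>R (b' - b)"]
    by (simp add: dist_norm)
  also have "\<dots> \<le> (1 - u) * \<rho> + u * \<rho>"
    using u assms by (intro add_mono mult_left_mono) auto
  finally have "dist ((1 - u) *\<^sub>R a' + u *\<^sub>R b') z \<le> \<rho>" by (simp add: algebra_simps)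
  moreover have "(1 - u) *\<^sub>R a' + u *\<^sub>R b' \<in> closed_segment a' b'"
    using u by (auto simp: in_segment)
  ultimately show ?thesis by blast
qed

text \<open>Two disjoint compact sets have a positive distance \<open>d\<close>. With \<rho> below
  \<open>d / 2\<close>, one \<rho> pays for the motion of the endpoints and another is left as a
  margin, which later absorbs the motion of a second segment or the width of an obstacle.\<close>

lemma eventually_segment_away:
  fixes a b :: "'a :: euclidean_space"
  assumes "compact K" "closed_segment a b \<inter> K = {}"
  shows "\<forall>\<^sub>F \<rho> in at_right (0::real). \<forall>a' b'. dist a' a \<le> \<rho> \<longrightarrow> dist b' b \<le> \<rho> \<longrightarrow>
    (\<forall>z\<in>closed_segment a' b'. \<forall>w\<in>K. \<rho> < dist z w)"
proof -
  obtain d where d: "d > 0" "\<And>z w. z \<in> closed_segment a b \<Longrightarrow> w \<in> K \<Longrightarrow> d \<le> dist z w"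
    using separate_compact_closed[OF compact_segment compact_imp_closed[OF assms(1)] assms(2)] by blast
  have "\<forall>\<^sub>F \<rho> in at_right (0::real). \<rho> < d / 2"
    using d(1) by (intro order_tendstoD(2)[OF tendsto_ident_at]) auto
  then show ?thesis
  proof eventually_elim
    case (elim \<rho>)
    have "\<rho> < dist z w" if h: "dist a' a \<le> \<rho>" "dist b' b \<le> \<rho>" "z \<in> closed_segment a' b'" "w \<in> K" for a' b' z w
    proof -
      obtain z0 where "z0 \<in> closed_segment a b" "dist z0 z \<le> \<rho>"
        using closed_segment_perturb[of a a' \<rho> b b' z] h by (auto simp: dist_commute)
      then show ?thesis
        using d(2)[of z0 w] h(4) dist_triangle[of z0 w z] elim by linarith
    qed
    then show ?case by blast
  qed
qed

lemma eventually_segment_meets_open: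
  fixes a b :: "'a :: real_normed_vector"
  assumes "open U" "closed_segment a b \<inter> U \<noteq> {}"
  shows "\<forall>\<^sub>F \<rho> in at_right (0::real). \<forall>a' b'. dist a' a \<le> \<rho> \<longrightarrow> dist b' b \<le> \<rho> \<longrightarrow>
    closed_segment a' b' \<inter> U \<noteq> {}"
proof -
  obtain z e where z: "z \<in> closed_segment a b" "e > 0" "ball z e \<subseteq> U"
    using assms by (meson disjoint_iff openE)
  have "\<forall>\<^sub>F \<rho> in at_right (0::real). \<rho> < e"
    using z(2) by (intro order_tendstoD(2)[OF tendsto_ident_at]) auto
  then show ?thesis
  proof eventually_elim
    case (elim \<rho>)
    have "closed_segment a' b' \<inter> U \<noteq> {}" if "dist a' a \<le> \<rho>" "dist b' b \<le> \<rho>" for a' b'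
      using closed_segment_perturb[OF that z(1)] elim z(3)
      by (force simp: dist_commute)
    then show ?case by blast
  qed
qed

section \<open>Robust representations\<close>

text \<open>The heights of the vertices never change during the construction. The quadratic term of
  \<open>height\<close> is a small perturbation of equally spaced points; \<open>base\<close> just has to exceed it by far.\<close>

definition base :: "nat \<Rightarrow> real" where
  "base n = 8 * (real n + 1)\<^sup>2"

definition height :: "nat \<Rightarrow> nat \<Rightarrow> real" where
  "height n i = base n * real i + (real i)\<^sup>2"

definition pt :: "nat \<Rightarrow> (nat \<Rightarrow> real) \<Rightarrow> nat \<Rightarrow> real ^ 2" where
  "pt n x i = vector [x i, height n i]"

abbreviation seg :: "nat \<Rightarrow> (nat \<Rightarrow> real) \<Rightarrow> nat \<Rightarrow> nat \<Rightarrow> (real ^ 2) set" where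
  "seg n x i j \<equiv> closed_segment (pt n x i) (pt n x j)"

text \<open>Requiring non-edges to meet the interior of an obstacle makes the notion stable under small
  perturbations.\<close>

definition robust_representation ::
    "nat \<Rightarrow> (nat \<Rightarrow> real) \<Rightarrow> (nat \<Rightarrow> nat \<Rightarrow> bool) \<Rightarrow> (real ^ 2) set set \<Rightarrow> bool" where
  "robust_representation n x R Obs \<longleftrightarrow>
     finite Obs \<and> (\<forall>P\<in>Obs. polygon P \<and> convex P \<and> compact P) \<and>
     (\<forall>i j. i < j \<longrightarrow> j < n \<longrightarrow>
        (if R i j then \<forall>P\<in>Obs. seg n x i j \<inter> P = {}
         else \<exists>P\<in>Obs. seg n x i j \<inter> interior P \<noteq> {}))"

lemma pt_nth [simp]: "pt n x i $ 1 = x i" "pt n x i $ 2 = height n i"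
  by (simp_all add: pt_def)

lemma dist_pt: "dist (pt n x i) (pt n x' i) = \<bar>x i - x' i\<bar>"
  by (simp add: pt_def dist_vec_def L2_set_def sum_2 dist_real_def)

lemma height_strict_mono: "i < j \<Longrightarrow> height n i < height n j"
  unfolding height_def base_def
  by (intro add_strict_mono mult_strict_left_mono power_strict_mono) auto

lemma height_le_iff [simp]: "height n i \<le> height n j \<longleftrightarrow> i \<le> j"
  using height_strict_mono[of i j n] height_strict_mono[of j i n]
  by (metis dual_order.order_iff_strict linorder_not_less)

lemma height_less_iff [simp]: "height n i < height n j \<longleftrightarrow> i < j"
  by (simp add: less_le_not_le)

lemma height_eq_iff [simp]: "height n i = height n j \<longleftrightarrow> i = j"
  by (simp add: order_eq_iff)

text \<open>Each pair imposes an open condition: missing finitely many compact sets, or meeting one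
  open set. There are finitely many pairs, so a common \<rho> exists.\<close>

lemma robust_representation_eventually:
  assumes "robust_representation n x R Obs"
  shows "\<forall>\<^sub>F \<rho> in at_right (0::real). \<forall>x'. (\<forall>i<n. \<bar>x' i - x i\<bar> \<le> \<rho>) \<longrightarrow>
    robust_representation n x' R Obs"
proof -
  note rep = assms[unfolded robust_representation_def]
  have "\<forall>\<^sub>F \<rho> in at_right (0::real). \<forall>i\<in>{..<n}. \<forall>j\<in>{..<n}. i < j \<longrightarrow>
      (\<forall>x'. (\<forall>i<n. \<bar>x' i - x i\<bar> \<le> \<rho>) \<longrightarrow>
        (if R i j then \<forall>P\<in>Obs. seg n x' i j \<inter> P = {}
         else \<exists>P\<in>Obs. seg n x' i j \<inter> interior P \<noteq> {}))" (is "\<forall>\<^sub>F \<rho> in _. \<forall>i\<in>_. \<forall>j\<in>_. ?Q i j \<rho>")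
  proof (intro eventually_ball_finite ballI finite_lessThan)
    fix i j assume "i \<in> {..<n}" "j \<in> {..<n}"
    then have ij: "i < n" "j < n" by auto
    consider "\<not> i < j" | "i < j" "R i j" | "i < j" "\<not> R i j" by blast
    then show "\<forall>\<^sub>F \<rho> in at_right 0. ?Q i j \<rho>"
    proof cases
      case 2
      have "\<forall>\<^sub>F \<rho> in at_right (0::real). \<forall>P\<in>Obs. \<forall>a' b'. dist a' (pt n x i) \<le> \<rho> \<longrightarrow>
          dist b' (pt n x j) \<le> \<rho> \<longrightarrow> (\<forall>z\<in>closed_segment a' b'. \<forall>w\<in>P. \<rho> < dist z w)"
        using rep 2 ij
        by (intro eventually_ball_finite ballI eventually_segment_away) auto
      moreover have "\<forall>\<^sub>F \<rho> in at_right (0::real). \<rho> > 0" by (rule eventually_at_right_less)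
      ultimately show ?thesis
      proof eventually_elim
        case (elim \<rho>)
        have "seg n x' i j \<inter> P = {}" if x': "\<forall>i<n. \<bar>x' i - x i\<bar> \<le> \<rho>" and P: "P \<in> Obs" for x' P
        proof -
          have "dist (pt n x' i) (pt n x i) \<le> \<rho>" "dist (pt n x' j) (pt n x j) \<le> \<rho>"
            using x' ij by (simp_all add: dist_pt)
          then have "\<forall>z\<in>seg n x' i j. \<forall>w\<in>P. \<rho> < dist z w"
            using elim(1) P by blast
          then show ?thesis using elim(2) by fastforce
        qed
        then show ?case using 2 by auto
      qed
    next
      case 3
      then obtain P where P: "P \<in> Obs" "seg n x i j \<inter> interior P \<noteq> {}"
        using rep ij by meson
      have "\<forall>\<^sub>F \<rho> in at_right (0::real). \<forall>a' b'. dist a' (pt n x i) \<le> \<rho> \<longrightarrow> dist b' (pt n x j) \<le> \<rho> \<longrightarrow>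
          closed_segment a' b' \<inter> interior P \<noteq> {}"
        using P(2) by (intro eventually_segment_meets_open open_interior)
      then show ?thesis
      proof eventually_elim
        case (elim \<rho>)
        have "seg n x' i j \<inter> interior P \<noteq> {}" if "\<forall>i<n. \<bar>x' i - x i\<bar> \<le> \<rho>" for x'
          using elim that ij by (simp add: dist_pt)
        then show ?case using 3 P(1) by (auto intro!: bexI[of _ P])
      qed
    qed simp
  qed
  then show ?thesis
    by eventually_elim (use rep in \<open>auto simp: robust_representation_def\<close>)
qed

text \<open>The frame shared by all rounds. A round has to offer, for every small \<rho>, a
  displacement by at most \<rho> together with finite sets whose hulls block the pairs to be turned
  into non-edges and avoid the remaining edges. Stability keeps the old obstacles valid, thickening
  makes obstacles of the hulls, and the index range bounds their number. \<open>Q\<close> carries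
  along what the next round needs to know about \<open>x'\<close>.\<close>

lemma robust_representation_refine:
  assumes rep: "robust_representation n x R Obs"
    and sub: "\<And>i j. R' i j \<Longrightarrow> R i j"
    and step: "\<forall>\<^sub>F \<rho> in at_right (0::real). \<exists>x' K. (\<forall>i<n. \<bar>x' i - x i\<bar> \<le> \<rho>) \<and> Q x' \<and>
      (\<forall>m. finite (K m)) \<and>
      (\<forall>i j m. i < j \<longrightarrow> j < n \<longrightarrow> R' i j \<longrightarrow> m < n - 1 \<longrightarrow> seg n x' i j \<inter> convex hull K m = {}) \<and>
      (\<forall>i j. i < j \<longrightarrow> j < n \<longrightarrow> R i j \<longrightarrow> \<not> R' i j \<longrightarrow> (\<exists>m<n - 1. seg n x' i j \<inter> convex hull K m \<noteq> {}))"
  obtains x' Obs' where "Q x'" "robust_representation n x' R' Obs'"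
    "card Obs' \<le> card Obs + (n - 1)"
proof -
  \<comment> \<open>Both the stability of the old obstacles and the offer in \<open>step\<close>
    hold for all small \<rho>, so one \<rho> serves both.\<close>
  obtain \<rho> :: real and x' K
    where \<rho>: "\<forall>x'. (\<forall>i<n. \<bar>x' i - x i\<bar> \<le> \<rho>) \<longrightarrow> robust_representation n x' R Obs"
    and near: "\<forall>i<n. \<bar>x' i - x i\<bar> \<le> \<rho>" and Q: "Q x'"
    and K': "\<forall>m. finite (K m)"
      "\<forall>i j m. i < j \<longrightarrow> j < n \<longrightarrow> R' i j \<longrightarrow> m < n - 1 \<longrightarrow> seg n x' i j \<inter> convex hull K m = {}"
      "\<forall>i j. i < j \<longrightarrow> j < n \<longrightarrow> R i j \<longrightarrow> \<not> R' i j \<longrightarrow> (\<exists>m<n - 1. seg n x' i j \<inter> convex hull K m \<noteq> {})"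
    using eventually_happens'[OF trivial_limit_at_right_real
        eventually_conj[OF robust_representation_eventually[OF rep] step]]
    by (elim exE conjE) blast
  have K: "\<And>m. finite (K m)"
      "\<And>i j m. i < j \<Longrightarrow> j < n \<Longrightarrow> R' i j \<Longrightarrow> m < n - 1 \<Longrightarrow> seg n x' i j \<inter> convex hull K m = {}"
      "\<And>i j. i < j \<Longrightarrow> j < n \<Longrightarrow> R i j \<Longrightarrow> \<not> R' i j \<Longrightarrow> \<exists>m<n - 1. seg n x' i j \<inter> convex hull K m \<noteq> {}"
    using K' by auto
  have x': "robust_representation n x' R Obs" "Q x'"
    using \<rho> near Q by blast+
  have compact: "compact (convex hull K m)" for m
    using K(1) by (simp add: compact_convex_hull finite_imp_compact)
  have "\<forall>\<^sub>F \<rho> in at_right (0::real). \<forall>i\<in>{..<n}. \<forall>j\<in>{..<n}. \<forall>m\<in>{..<n - 1}. i < j \<longrightarrow> R' i j \<longrightarrow>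
      (\<forall>z\<in>seg n x' i j. \<forall>w\<in>convex hull K m. \<rho> < dist z w)"
  proof (intro eventually_ball_finite ballI finite_lessThan)
    fix i j m assume "i \<in> {..<n}" "j \<in> {..<n}" "m \<in> {..<n - 1}"
    show "\<forall>\<^sub>F \<rho> in at_right (0::real). i < j \<longrightarrow> R' i j \<longrightarrow>
      (\<forall>z\<in>seg n x' i j. \<forall>w\<in>convex hull K m. \<rho> < dist z w)"
    proof (cases "i < j \<and> R' i j")
      case True
      then have "seg n x' i j \<inter> convex hull K m = {}" using K(2) \<open>j \<in> _\<close> \<open>m \<in> _\<close> by simp
      from eventually_conj[OF eventually_segment_away[OF compact this] eventually_at_right_less]
      show ?thesis
      proof eventually_elim
        case (elim \<rho>)
        then have "dist (pt n x' i) (pt n x' i) \<le> \<rho>" "dist (pt n x' j) (pt n x' j) \<le> \<rho>" by auto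
        then show ?case using elim by blast
      qed
    qed auto
  qed
  from eventually_happens'[OF trivial_limit_at_right_real eventually_conj[OF this eventually_at_right_less]]
  obtain \<delta> :: real where \<delta>: "\<delta> > 0" "\<And>i j m z w. i < j \<Longrightarrow> j < n \<Longrightarrow> R' i j \<Longrightarrow> m < n - 1 \<Longrightarrow>
      z \<in> seg n x' i j \<Longrightarrow> w \<in> convex hull K m \<Longrightarrow> \<delta> < dist z w"
    by (elim exE conjE) (rule that; force)
  \<comment> \<open>All remaining edges stay more than \<delta> away from all hulls, so thickening
    by at most \<delta> creates no new contact.\<close>
  have "\<exists>P. polytope P \<and> convex hull K m \<subseteq> interior P \<and> (\<forall>w\<in>P. \<exists>z\<in>convex hull K m. dist z w \<le> \<delta>)"
    if "K m \<noteq> {}" for m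
    using polytope_thickening[OF K(1) that \<delta>(1)] by metis
  then obtain P where P: "\<And>m. K m \<noteq> {} \<Longrightarrow> polytope (P m)"
      "\<And>m. K m \<noteq> {} \<Longrightarrow> convex hull K m \<subseteq> interior (P m)"
      "\<And>m w. K m \<noteq> {} \<Longrightarrow> w \<in> P m \<Longrightarrow> \<exists>z\<in>convex hull K m. dist z w \<le> \<delta>"
    by metis
  define New where "New = P ` {m. m < n - 1 \<and> K m \<noteq> {}}"
  have New: "polygon S \<and> convex S \<and> compact S" if "S \<in> New" for S
  proof -
    obtain m where m: "S = P m" "K m \<noteq> {}" using \<open>S \<in> New\<close> by (auto simp: New_def)
    then have "interior S \<noteq> {}" using P(2)[of m] by auto
    then show ?thesis
      using P(1)[OF m(2)] m(1) polygon_polytope polytope_imp_convex polytope_imp_compact by blast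
  qed
  have avoid: "seg n x' i j \<inter> S = {}" if ij: "i < j" "j < n" "R' i j" and S: "S \<in> New" for i j S
  proof -
    obtain m where m: "S = P m" "K m \<noteq> {}" "m < n - 1" using S by (auto simp: New_def)
    have False if "w \<in> seg n x' i j" "w \<in> S" for w
    proof -
      obtain z where z: "z \<in> convex hull K m" "dist z w \<le> \<delta>" using P(3)[OF m(2)] m(1) \<open>w \<in> S\<close> by blast
      then show False using \<delta>(2)[OF ij m(3) \<open>w \<in> seg n x' i j\<close> z(1)] by (simp add: dist_commute)
    qed
    then show ?thesis by blast
  qed
  have meet: "\<exists>S\<in>New. seg n x' i j \<inter> interior S \<noteq> {}" if "i < j" "j < n" "R i j" "\<not> R' i j" for i j
  proof -
    obtain m where m: "m < n - 1" "seg n x' i j \<inter> convex hull K m \<noteq> {}"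
      using K(3) \<open>i < j\<close> \<open>j < n\<close> \<open>R i j\<close> \<open>\<not> R' i j\<close> by blast
    then have "K m \<noteq> {}" by auto
    then show ?thesis using P(2)[of m] m by (auto simp: New_def)
  qed
  have "card New \<le> card {m. m < n - 1 \<and> K m \<noteq> {}}"
    unfolding New_def by (intro card_image_le) simp
  also have "\<dots> \<le> card {..<n - 1}" by (intro card_mono) auto
  finally have "card (Obs \<union> New) \<le> card Obs + (n - 1)"
    using card_Un_le[of Obs New] by simp
  moreover have "robust_representation n x' R' (Obs \<union> New)"
    unfolding robust_representation_def
  proof (intro conjI allI impI)
    show "finite (Obs \<union> New)" using x'(1) by (simp add: robust_representation_def New_def)
    show "\<forall>P\<in>Obs \<union> New. polygon P \<and> convex P \<and> compact P"
      using x'(1) New by (auto simp: robust_representation_def)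
    fix i j assume ij: "i < j" "j < n"
    have old: "if R i j then \<forall>P\<in>Obs. seg n x' i j \<inter> P = {}
         else \<exists>P\<in>Obs. seg n x' i j \<inter> interior P \<noteq> {}"
      using x'(1) ij unfolding robust_representation_def by blast
    show "if R' i j then \<forall>P\<in>Obs \<union> New. seg n x' i j \<inter> P = {}
         else \<exists>P\<in>Obs \<union> New. seg n x' i j \<inter> interior P \<noteq> {}"
    proof (cases "R' i j")
      case True
      then show ?thesis using old sub[OF True] avoid[OF ij True] by auto
    next
      case False
      show ?thesis
      proof (cases "R i j")
        case True
        then show ?thesis using meet[OF ij True False] False by auto
      next
        case False
        then show ?thesis using old \<open>\<not> R' i j\<close> by auto
      qed
    qed
  qed
  ultimately show ?thesis using that x'(2) by blast
qed

section \<open>Tangents of a parabola\<close>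

text \<open>Separation by the line with normal vector (\<alpha>, \<beta>): an open half-plane
  contains the hull, and the complementary closed one contains the segment.\<close>

lemma closed_segment_disjoint_convex_hull:
  fixes K :: "(real ^ 2) set"
  assumes "\<And>w. w \<in> K \<Longrightarrow> c < \<alpha> * w $ 1 + \<beta> * w $ 2"
    and "\<alpha> * a $ 1 + \<beta> * a $ 2 \<le> c" "\<alpha> * b $ 1 + \<beta> * b $ 2 \<le> c"
  shows "closed_segment a b \<inter> convex hull K = {}"
proof -
  define v :: "real ^ 2" where "v = vector [\<alpha>, \<beta>]"
  have v: "v \<bullet> z = \<alpha> * z $ 1 + \<beta> * z $ 2" for z
    by (simp add: v_def inner_vec_def sum_2)
  have "convex hull K \<subseteq> {z. c < v \<bullet> z}"
    using assms(1) by (intro hull_minimal) (auto simp: v convex_halfspace_gt[of c v, unfolded v])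
  moreover have "closed_segment a b \<subseteq> {z. v \<bullet> z \<le> c}"
    using assms(2,3) by (intro closed_segment_subset convex_halfspace_le) (auto simp: v)
  ultimately show ?thesis by fastforce
qed

text \<open>Fix \<open>s = i + j\<close> and let \<open>N = base n\<close>. At parameter
  \<open>t\<close> the segment from the vertex \<open>i\<close> on the left line to the vertex
  \<open>j\<close> on the right line has height \<open>N i + i^2 + t (s - 2 i) (N + s)\<close>.
  Setting its derivative in \<open>i\<close> to zero gives
  \<open>t = (N + 2 i) / (2 (N + s))\<close>, the point of contact with the envelope of the
  family.\<close>

definition tangent_point :: "nat \<Rightarrow> real \<Rightarrow> real \<Rightarrow> nat \<Rightarrow> nat \<Rightarrow> real ^ 2" where
  "tangent_point n x0 \<epsilon> i j =
     vector [x0 + \<epsilon> * ((base n + 2 * real i) / (2 * (base n + real (i + j)))),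
             base n * real (i + j) / 2 + real i * real j]"

lemma tangent_point_nth [simp]:
  "tangent_point n x0 \<epsilon> i j $ 1 = x0 + \<epsilon> * ((base n + 2 * real i) / (2 * (base n + real (i + j))))"
  "tangent_point n x0 \<epsilon> i j $ 2 = base n * real (i + j) / 2 + real i * real j"
  by (simp_all add: tangent_point_def)

lemma base_pos: "base n > 0"
  by (simp add: base_def)

lemma tangent_point_x_bounds:
  assumes "\<epsilon> > 0"
  shows "x0 < tangent_point n x0 \<epsilon> i j $ 1" "tangent_point n x0 \<epsilon> i j $ 1 < x0 + \<epsilon>"
proof -
  define t where "t = (base n + 2 * real i) / (2 * (base n + real (i + j)))"
  have "0 < t"
    unfolding t_def using base_pos[of n] by (intro divide_pos_pos) auto
  moreover have "t < 1"
    unfolding t_def using base_pos[of n] by (subst divide_less_eq_1_pos) auto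
  ultimately have "0 < \<epsilon> * t" "\<epsilon> * t < \<epsilon>"
    using assms by auto
  then show "x0 < tangent_point n x0 \<epsilon> i j $ 1" "tangent_point n x0 \<epsilon> i j $ 1 < x0 + \<epsilon>"
    unfolding tangent_point_nth t_def[symmetric] by auto
qed

text \<open>The product \<open>i * j\<close> equals \<open>(s^2 - (i - j)^2) / 4\<close>, and
  distinct integers differ by at least 1. This gain of 1/4 keeps the band strictly below a vertex of
  index \<open>s / 2\<close>.\<close>

lemma tangent_point_y_bounds:
  assumes "i \<noteq> j" "i + j = s"
  shows "base n * real s / 2 \<le> tangent_point n x0 \<epsilon> i j $ 2"
    and "tangent_point n x0 \<epsilon> i j $ 2 \<le> base n * real s / 2 + ((real s)\<^sup>2 - 1) / 4"
proof -
  show "base n * real s / 2 \<le> tangent_point n x0 \<epsilon> i j $ 2"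
    using assms by simp
  have "1 \<le> \<bar>real i - real j\<bar>" using assms(1) by linarith
  then have "1 \<le> (real i - real j)\<^sup>2"
    using one_le_power[of "\<bar>real i - real j\<bar>" 2] by simp
  then show "tangent_point n x0 \<epsilon> i j $ 2 \<le> base n * real s / 2 + ((real s)\<^sup>2 - 1) / 4"
    using assms(2) by (auto simp: power2_eq_square field_simps)
qed

lemma tangent_point_in_segment:
  "tangent_point n x0 \<epsilon> i j \<in> closed_segment (vector [x0, height n i]) (vector [x0 + \<epsilon>, height n j])"
proof -
  define N where "N = base n"
  have N: "N > 0" by (simp add: N_def base_pos)
  define t where "t = (N + 2 * real i) / (2 * (N + real i + real j))"
  have D: "2 * (N + real i + real j) > 0" using N by auto
  have t: "0 \<le> t" "t \<le> 1" using N D unfolding t_def by auto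
  have tD: "t * (2 * (N + real i + real j)) = N + 2 * real i" using D unfolding t_def by simp
  have "(base n * real (i + j) / 2 + real i * real j) * (2 * (N + real i + real j)) =
     ((1 - t) * height n i + t * height n j) * (2 * (N + real i + real j))"
  proof -
    have eq: "((1 - t) * height n i + t * height n j) * (2 * (N + real i + real j)) =
      height n i * (2 * (N + real i + real j)) + (t * (2 * (N + real i + real j))) * (height n j - height n i)"
      by (simp add: algebra_simps)
    show ?thesis unfolding eq unfolding tD height_def N_def[symmetric]
      by (simp add: field_simps power2_eq_square)
  qed
  then have "base n * real (i + j) / 2 + real i * real j = (1 - t) * height n i + t * height n j"
    using D by simp
  moreover have "tangent_point n x0 \<epsilon> i j = vector [x0 + \<epsilon> * t, base n * real (i + j) / 2 + real i * real j]"
    by (simp add: tangent_point_def t_def N_def add.assoc)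
  moreover have "x0 + \<epsilon> * t = (1 - t) * x0 + t * (x0 + \<epsilon>)" by (simp add: algebra_simps)
  ultimately have "tangent_point n x0 \<epsilon> i j =
      (1 - t) *\<^sub>R vector [x0, height n i] + t *\<^sub>R vector [x0 + \<epsilon>, height n j]"
    by (simp add: vec_eq_iff forall_2)
  then show ?thesis using t by (auto simp: in_segment)
qed

lemma tangent_point_y_between:
  assumes "i \<le> j"
  shows "height n i \<le> tangent_point n x0 \<epsilon> i j $ 2" "tangent_point n x0 \<epsilon> i j $ 2 \<le> height n j"
proof -
  have "base n * real i \<le> base n * real j" "real i * real i \<le> real i * real j" "real i * real j \<le> real j * real j"
    using assms base_pos[of n] by (auto intro: mult_left_mono mult_right_mono)
  then show "height n i \<le> tangent_point n x0 \<epsilon> i j $ 2" "tangent_point n x0 \<epsilon> i j $ 2 \<le> height n j"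
    by (simp_all add: height_def power2_eq_square field_simps)
qed

text \<open>If \<open>2 * l < s\<close>, then \<open>l\<close> lies at least half a step of
  \<open>base n\<close> below the band, and the quadratic term is too small to bridge that.
  Otherwise linear and quadratic term are at least \<open>base n * s / 2\<close> and
  \<open>s^2 / 4\<close>, which is 1/4 above the top of the band.\<close>

lemma height_outside_level:
  assumes "l < n" "s < 2 * n"
  shows "height n l < base n * real s / 2 \<or> base n * real s / 2 + ((real s)\<^sup>2 - 1) / 4 < height n l"
proof (cases "2 * l < s")
  case True
  have "(real l)\<^sup>2 \<le> (real n)\<^sup>2" using assms by (intro power_mono) auto
  also have "\<dots> < base n / 2"
    by (simp add: base_def power2_eq_square algebra_simps) (intro add_pos_nonneg; simp)
  finally have "(real l)\<^sup>2 < base n / 2" .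
  moreover have "base n * (2 * real l + 1) \<le> base n * real s"
    using True base_pos[of n] by (intro mult_left_mono) auto
  ultimately show ?thesis by (simp add: height_def algebra_simps)
next
  case False
  then have "real s \<le> 2 * real l" by simp
  then have "base n * real s \<le> base n * (2 * real l)" "(real s)\<^sup>2 \<le> (2 * real l)\<^sup>2"
    using base_pos[of n] by (intro mult_left_mono power_mono; simp)+
  then have "base n * real s / 2 + ((real s)\<^sup>2 - 1) / 4 < height n l"
    by (simp add: height_def power_mult_distrib field_simps)
  then show ?thesis ..
qed

text \<open>For fixed \<open>i + j\<close> the lines through \<open>(0, height n i)\<close> and \<open>(1, height n j)\<close> are tangents of
  one parabola, touching it in the tangent points; lines with different \<open>i + j\<close> are so far apart
  that they are ordered there by \<open>i + j\<close>.\<close>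

lemma tangent_point_line:
  assumes "i < n" "j < n" "i' < n" "j' < n"
  defines "D \<equiv> height n i' + (height n j' - height n i') *
      ((base n + 2 * real i) / (2 * (base n + real (i + j)))) - (base n * real (i + j) / 2 + real i * real j)"
  shows "i + j < i' + j' \<Longrightarrow> D > 0" "i' + j' < i + j \<Longrightarrow> D < 0"
    "i' + j' = i + j \<Longrightarrow> i' \<noteq> i \<Longrightarrow> D > 0"
proof -
  define N where "N = base n"
  have N: "N > 0" by (simp add: N_def base_pos)
  define a b c d where "a = real i" and "b = real j" and "c = real i'" and "d = real j'"
  note abcd = a_def b_def c_def d_def
  define M where "M = real n"
  have bnd: "0 \<le> a" "a \<le> M" "0 \<le> b" "b \<le> M" "0 \<le> c" "c \<le> M" "0 \<le> d" "d \<le> M"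
    using assms by (auto simp: abcd M_def)
  have pos: "0 < 2 * (N + (a + b))" using N bnd by simp
  have tD: "(N + 2 * a) / (2 * (N + (a + b))) * (2 * (N + (a + b))) = N + 2 * a"
    using pos by simp
  \<comment> \<open>\<open>E\<close> is \<open>D\<close> with its positive denominator cleared,
    sorted by powers of \<open>N\<close>. For different index sums the integer factor of
    \<open>N^2\<close> is at least 1 in absolute value and decides the sign.\<close>
  define E where "E = N\<^sup>2 * ((c + d) - (a + b)) +
      N * ((c + d)\<^sup>2 - (a + b)\<^sup>2 - 2 * c * d - 2 * a * b + 2 * b * c + 2 * a * d) +
      2 * (b * c\<^sup>2 + a * d\<^sup>2 - a * b * (a + b))"
  have DE: "D * (2 * (N + (a + b))) = E"
  proof -
    have "D * (2 * (N + (a + b))) = height n i' * (2 * (N + (a + b))) +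
       (height n j' - height n i') * ((N + 2 * a) / (2 * (N + (a + b))) * (2 * (N + (a + b)))) -
       (N * (a + b) / 2 + a * b) * (2 * (N + (a + b)))"
      unfolding D_def by (simp add: N_def abcd algebra_simps)
    also have "\<dots> = E"
      unfolding tD height_def E_def N_def[symmetric] abcd[symmetric]
      by (simp add: field_simps power2_eq_square)
    finally show ?thesis .
  qed
  have D_pos: "D > 0 \<longleftrightarrow> E > 0" and D_neg: "D < 0 \<longleftrightarrow> E < 0"
    using pos not_less_iff_gr_or_eq[of 0 "2 * (N + (a + b))"]
    by (simp_all only: DE[symmetric] zero_less_mult_iff mult_less_0_iff, blast+)
  have sq: "p * q \<le> M\<^sup>2" "0 \<le> p * q" if "0 \<le> p" "p \<le> M" "0 \<le> q" "q \<le> M" for p q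
  proof -
    show "p * q \<le> M\<^sup>2" unfolding power2_eq_square using that by (intro mult_mono) auto
    show "0 \<le> p * q" using that by (intro mult_nonneg_nonneg)
  qed
  have M: "0 \<le> M" by (simp add: M_def)
  have cu: "p * q * r \<le> M ^ 3" "0 \<le> p * q * r"
    if "0 \<le> p" "p \<le> M" "0 \<le> q" "q \<le> M" "0 \<le> r" "r \<le> M" for p q r
  proof -
    have "p * q * r \<le> M\<^sup>2 * M" using that M by (intro mult_mono[OF sq(1)]) auto
    then show "p * q * r \<le> M ^ 3" by (simp add: power3_eq_cube power2_eq_square)
    show "0 \<le> p * q * r" using that by (intro mult_nonneg_nonneg)
  qed
  \<comment> \<open>Here the size of \<open>base n\<close> enters: \<open>N^2\<close> outweighs
    \<open>4 * N * M^2 + 4 * M^3\<close>, the bound for the adverse lower-order terms.\<close>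
  have big: "N * (N - 4 * M\<^sup>2) > 4 * M ^ 3"
  proof -
    have N8: "N = 8 * (M + 1)\<^sup>2" by (simp add: N_def base_def M_def)
    have "4 * M ^ 3 \<le> (4 * M\<^sup>2) * (4 * M + 4)"
      using M by (simp add: power3_eq_cube power2_eq_square algebra_simps)
    also have "\<dots> < N * (N - 4 * M\<^sup>2)"
    proof (rule mult_strict_mono)
      show "4 * M\<^sup>2 < N" using M by (simp add: N8 power2_eq_square algebra_simps add_pos_nonneg)
      show "4 * M + 4 < N - 4 * M\<^sup>2" using M by (simp add: N8 power2_eq_square algebra_simps add_pos_nonneg)
    qed (use M N in auto)
    finally show ?thesis .
  qed
  have cross: "2 * c * d + 2 * a * b \<le> 4 * M\<^sup>2" "2 * b * c + 2 * a * d \<le> 4 * M\<^sup>2"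
    "0 \<le> 2 * c * d + 2 * a * b" "0 \<le> 2 * b * c + 2 * a * d"
    using sq[OF bnd(5-8)] sq[OF bnd(1-4)] sq[OF bnd(3-6)] sq[OF bnd(1,2,7,8)]
    by (simp_all add: algebra_simps)
  have cubic: "b * c\<^sup>2 + a * d\<^sup>2 \<le> 2 * M ^ 3" "0 \<le> b * c\<^sup>2 + a * d\<^sup>2"
    "a * b * (a + b) \<le> 2 * M ^ 3" "0 \<le> a * b * (a + b)"
    using cu[OF bnd(3,4,5,6,5,6)] cu[OF bnd(1,2,7,8,7,8)] cu[OF bnd(1-4,1,2)] cu[OF bnd(1-4,3,4)]
    by (simp_all add: power2_eq_square algebra_simps)
  show "D > 0" if "i + j < i' + j'"
  proof -
    have s: "a + b + 1 \<le> c + d" using that by (simp add: abcd)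
    then have "(a + b)\<^sup>2 \<le> (c + d)\<^sup>2" using bnd by (intro power_mono) auto
    then have "N * (- 4 * M\<^sup>2) \<le> N * ((c + d)\<^sup>2 - (a + b)\<^sup>2 - 2 * c * d - 2 * a * b + 2 * b * c + 2 * a * d)"
      using cross N by (intro mult_left_mono) auto
    moreover have "N\<^sup>2 * 1 \<le> N\<^sup>2 * ((c + d) - (a + b))" using s by (intro mult_left_mono) auto
    ultimately have "E > 0" unfolding E_def using cubic big
      by (simp add: algebra_simps power2_eq_square)
    then show ?thesis by (simp add: D_pos)
  qed
  show "D < 0" if "i' + j' < i + j"
  proof -
    have s: "c + d + 1 \<le> a + b" using that by (simp add: abcd)
    then have "(c + d)\<^sup>2 \<le> (a + b)\<^sup>2" using bnd by (intro power_mono) auto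
    then have "N * ((c + d)\<^sup>2 - (a + b)\<^sup>2 - 2 * c * d - 2 * a * b + 2 * b * c + 2 * a * d) \<le> N * (4 * M\<^sup>2)"
      using cross N by (intro mult_left_mono) auto
    moreover have "N\<^sup>2 * ((c + d) - (a + b)) \<le> N\<^sup>2 * (- 1)" using s by (intro mult_left_mono) auto
    ultimately have "E < 0" unfolding E_def using cubic big
      by (simp add: algebra_simps power2_eq_square)
    then show ?thesis by (simp add: D_neg)
  qed
  show "D > 0" if "i' + j' = i + j" "i' \<noteq> i"
  proof -
    have s: "d = a + b - c" using that(1) by (simp add: abcd)
    \<comment> \<open>Tangency shows as a double zero at \<open>c = a\<close>: all lines with this
      index sum pass above the points of contact of the others.\<close>
    have "E = 2 * (N + (a + b)) * (c - a)\<^sup>2"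
      unfolding E_def s by (simp add: algebra_simps power2_eq_square)
    moreover have "(c - a)\<^sup>2 > 0" using that(2) by (simp add: abcd)
    ultimately show ?thesis using pos by (simp add: D_pos)
  qed
qed

section \<open>Splitting clusters\<close>

text \<open>Vertices with the same key form a cluster, drawn on a common vertical line that no segment
  between two vertices outside the cluster crosses within the height range of the cluster.\<close>

definition clustered :: "nat \<Rightarrow> (nat \<Rightarrow> nat) \<Rightarrow> (nat \<Rightarrow> real) \<Rightarrow> bool" where
  "clustered n k x \<longleftrightarrow>
     (\<forall>i<n. \<forall>j<n. x i = x j \<longleftrightarrow> k i = k j) \<and>
     (\<forall>i<n. \<forall>j<n. \<forall>a b. a \<le> b \<longrightarrow> b < n \<longrightarrow> k a = k b \<longrightarrow> k i \<noteq> k a \<longrightarrow> k j \<noteq> k a \<longrightarrow>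
        seg n x i j \<inter> seg n x a b = {})"

lemma clustered_x_eq_iff: "clustered n k x \<Longrightarrow> i < n \<Longrightarrow> j < n \<Longrightarrow> x i = x j \<longleftrightarrow> k i = k j"
  by (simp add: clustered_def)

lemma seg_nthD:
  assumes "z \<in> seg n x i j"
  obtains u where "0 \<le> u" "u \<le> 1" "z $ 1 = (1 - u) * x i + u * x j"
    "z $ 2 = (1 - u) * height n i + u * height n j"
  using assms by (auto simp: in_segment)

lemma seg_at_endpoint:
  assumes "z \<in> seg n x i j" "x i \<noteq> x j" "z $ 1 = x i"
  shows "z $ 2 = height n i"
proof -
  obtain u where u: "z $ 1 = (1 - u) * x i + u * x j"
      "z $ 2 = (1 - u) * height n i + u * height n j"
    using assms(1) by (rule seg_nthD)
  have "u * (x j - x i) = 0" using u(1) assms(3) by (auto simp: algebra_simps)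
  then show ?thesis using u(2) assms(2) by simp
qed

lemma mem_vertical_segment:
  fixes z :: "real ^ 2"
  assumes "lo \<le> hi"
  shows "z \<in> closed_segment (vector [c, lo]) (vector [c, hi]) \<longleftrightarrow> z $ 1 = c \<and> lo \<le> z $ 2 \<and> z $ 2 \<le> hi"
proof -
  have "z \<in> closed_segment (vector [c, lo]) (vector [c, hi]) \<longleftrightarrow> z $ 1 = c \<and> z $ 2 \<in> closed_segment lo hi"
    by (auto simp: in_segment vec_eq_iff forall_2 algebra_simps)
  then show ?thesis using assms by (simp add: closed_segment_eq_real_ivl)
qed

lemma seg_vertical:
  assumes "x i = x j" "i \<le> j"
  shows "z \<in> seg n x i j \<longleftrightarrow> z $ 1 = x i \<and> height n i \<le> z $ 2 \<and> z $ 2 \<le> height n j"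
  using mem_vertical_segment[of "height n i" "height n j" z "x i"] assms by (simp add: pt_def)

text \<open>By \<open>clustered\<close>, a segment meeting the cluster within its height range has
  an endpoint in the cluster. As its endpoints belong to different clusters it is not vertical, so
  it meets the line of the cluster in that endpoint only.\<close>

lemma clustered_crossing_height:
  assumes "clustered n k x" "i < n" "j < n" "k i \<noteq> k j" "a \<le> b" "b < n" "k a = k b"
    and z: "z \<in> seg n x i j" "z $ 1 = x a" "height n a \<le> z $ 2" "z $ 2 \<le> height n b"
  shows "\<exists>l\<in>{i, j}. z $ 2 = height n l \<and> k l = k a"
proof -
  have x: "x a = x b" "x i \<noteq> x j"
    using assms(1-7) by (auto simp: clustered_x_eq_iff)
  then have "z \<in> seg n x a b" using z assms(5) by (simp add: seg_vertical)
  then have "k i = k a \<or> k j = k a"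
    using assms z(1) unfolding clustered_def by (meson disjoint_iff)
  then show ?thesis
  proof
    assume "k i = k a"
    then have "x i = x a" using assms(1-6) by (simp add: clustered_x_eq_iff)
    then show ?thesis using seg_at_endpoint[OF z(1) x(2)] z(2) \<open>k i = k a\<close> by auto
  next
    assume "k j = k a"
    then have "x j = x a" using assms(1-6) by (simp add: clustered_x_eq_iff)
    moreover have "z \<in> seg n x j i" using z(1) by (simp add: closed_segment_commute)
    ultimately show ?thesis using seg_at_endpoint[of z n x j i] x(2) z(2) \<open>k j = k a\<close> by auto
  qed
qed

text \<open>The lowest bit of \<open>k'\<close> selects the half that moves. By \<open>gap\<close>,
  lines of different clusters cannot merge, and by \<open>far\<close>, disjoint segments stay
  disjoint although both move. Only segments that end in the other half of the same old cluster need
  a new argument.\<close>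

lemma clustered_split:
  assumes clu: "clustered n k x"
    and k: "\<And>i. k i = k' i div 2"
    and mono: "\<And>i j. i \<le> j \<Longrightarrow> j < n \<Longrightarrow> k' i \<le> k' j"
    and \<epsilon>: "\<epsilon> > 0"
    and x'_def: "\<And>i. x' i = x i + \<epsilon> * real (k' i mod 2)"
    and gap: "\<And>i j. i < n \<Longrightarrow> j < n \<Longrightarrow> x i \<noteq> x j \<Longrightarrow> \<epsilon> < \<bar>x i - x j\<bar>"
    and far: "\<And>i j a b z w. i < n \<Longrightarrow> j < n \<Longrightarrow> a < n \<Longrightarrow> b < n \<Longrightarrow> seg n x i j \<inter> seg n x a b = {} \<Longrightarrow>
      z \<in> seg n x' i j \<Longrightarrow> w \<in> seg n x a b \<Longrightarrow> \<epsilon> < dist z w"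
  shows "clustered n k' x'"
proof -
  have mod2: "k' i mod 2 = 0 \<or> k' i mod 2 = 1" for i by auto
  have x'_eq: "x' i = x' j \<longleftrightarrow> k' i = k' j" if "i < n" "j < n" for i j
  proof (cases "k i = k j")
    case True
    then have "x i = x j" using clu that by (simp add: clustered_x_eq_iff)
    moreover have "k' i = k' j \<longleftrightarrow> k' i mod 2 = k' j mod 2"
      using True unfolding k by (metis div_mult_mod_eq)
    ultimately show ?thesis using \<epsilon> by (simp add: x'_def)
  next
    case False
    then have "x i \<noteq> x j" using clu that by (simp add: clustered_x_eq_iff)
    then have "\<epsilon> < \<bar>x i - x j\<bar>" by (rule gap[OF that])
    then have "x' i \<noteq> x' j"
      using mod2[of i] mod2[of j] \<epsilon> by (auto simp: x'_def)
    then show ?thesis using False unfolding k by auto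
  qed
  have near: "dist (pt n x' i) (pt n x i) \<le> \<epsilon>" for i
    using mod2[of i] \<epsilon> by (auto simp: dist_pt x'_def)
  have apart: "seg n x' i j \<inter> seg n x' a b = {}"
    if "i < n" "j < n" "a < n" "b < n" "seg n x i j \<inter> seg n x a b = {}" for i j a b
  proof -
    have False if z: "z \<in> seg n x' i j" "z \<in> seg n x' a b" for z
    proof -
      obtain w where "w \<in> seg n x a b" "dist w z \<le> \<epsilon>"
        using closed_segment_perturb[of "pt n x a" "pt n x' a" \<epsilon> "pt n x b" "pt n x' b" z] near z(2)
        by (auto simp: dist_commute)
      then show False
        using far[OF \<open>i < n\<close> \<open>j < n\<close> \<open>a < n\<close> \<open>b < n\<close> \<open>seg n x i j \<inter> seg n x a b = {}\<close> z(1)]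
        by (force simp: dist_commute)
    qed
    then show ?thesis by blast
  qed
  \<comment> \<open>Before the shift, such a segment meets the line of the cluster only at the
    vertex \<open>i\<close>. Since \<open>k'\<close> is monotone and \<open>i\<close> lies in the
    other half, \<open>i\<close> is not between \<open>a\<close> and \<open>b\<close>.\<close>
  have half: "seg n x i j \<inter> seg n x a b = {}"
    if h: "i < n" "j < n" "a \<le> b" "b < n" "k' a = k' b" "k' i \<noteq> k' a" "k i = k a" "k j \<noteq> k a" for i j a b
  proof -
    have False if z: "z \<in> seg n x i j" "z \<in> seg n x a b" for z
    proof -
      have x: "x a = x b" "x i = x a" "x i \<noteq> x j"
        using clu h k by (auto simp: clustered_x_eq_iff)
      have "z $ 1 = x a" "height n a \<le> z $ 2" "z $ 2 \<le> height n b"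
        using z(2) seg_vertical[OF x(1) h(3)] by auto
      moreover have "z $ 2 = height n i"
        using seg_at_endpoint[OF z(1) x(3)] x(2) \<open>z $ 1 = x a\<close> by simp
      ultimately have "a \<le> i" "i \<le> b" by simp_all
      then have "k' a \<le> k' i" "k' i \<le> k' b" using mono[of a i] mono[of i b] h by simp_all
      then show False using h by simp
    qed
    then show ?thesis by blast
  qed
  have "seg n x' i j \<inter> seg n x' a b = {}"
    if h: "i < n" "j < n" "a \<le> b" "b < n" "k' a = k' b" "k' i \<noteq> k' a" "k' j \<noteq> k' a" for i j a b
  proof -
    have a: "a < n" using h by simp
    have kab: "k a = k b" using h(5) by (simp add: k)
    consider "k i \<noteq> k a" "k j \<noteq> k a" | "k i = k a" "k j = k a" | "k i = k a" "k j \<noteq> k a"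
      | "k j = k a" "k i \<noteq> k a" by blast
    then show ?thesis
    proof cases
      case 1
      then have "seg n x i j \<inter> seg n x a b = {}"
        using clu h kab unfolding clustered_def by blast
      then show ?thesis using apart h a by blast
    next
      case 2
      \<comment> \<open>A cluster has only two halves, so both endpoints lie in the same one; the
        two segments are then on different vertical lines.\<close>
      then have "k' i = k' j" using h(6,7) unfolding k by presburger
      then have x': "x' i = x' j" "x' a = x' b" "x' i \<noteq> x' a"
        using x'_eq h a by auto
      have "z $ 1 = x' i" if "z \<in> seg n x' i j" for z
        using that x'(1) by (elim seg_nthD) (simp add: algebra_simps)
      moreover have "z $ 1 = x' a" if "z \<in> seg n x' a b" for z
        using that x'(2) by (elim seg_nthD) (simp add: algebra_simps)
      ultimately show ?thesis using x'(3) by fastforce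
    next
      case 3
      then show ?thesis using apart[OF h(1,2) a h(4)] half[OF h(1-6)] by blast
    next
      case 4
      then have "seg n x j i \<inter> seg n x a b = {}" using half[OF h(2,1,3,4,5,7)] by blast
      then show ?thesis using apart[OF h(1,2) a h(4)] by (simp add: closed_segment_commute)
    qed
  qed
  then show ?thesis using x'_eq unfolding clustered_def by blast
qed

text \<open>One bit round. Pairs within a cluster count as edges until they are separated, so
  exactly the non-adjacent pairs between the two halves of a cluster need new obstacles; for each
  index sum, one hull of points of tangency blocks all of them.\<close>

lemma refine_split:
  assumes clu: "clustered n k x"
    and k: "\<And>i. k i = k' i div 2"
    and mono: "\<And>i j. i \<le> j \<Longrightarrow> j < n \<Longrightarrow> k' i \<le> k' j"
    and rep: "robust_representation n x (\<lambda>i j. adj i j \<or> k i = k j) Obs"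
  obtains x' Obs' where "clustered n k' x'"
    "robust_representation n x' (\<lambda>i j. adj i j \<or> k' i = k' j) Obs'"
    "card Obs' \<le> card Obs + (n - 1)"
proof -
  \<comment> \<open>The range of heights of the points of tangency with index sum \<open>s\<close>,
    drawn on the line of the cluster. Unlike the hulls it does not depend on \<epsilon>, so
    \<epsilon> can be chosen small against its distance from the old segments.\<close>
  define level where "level x0 s = closed_segment (vector [x0, base n * real s / 2] :: real ^ 2)
     (vector [x0, base n * real s / 2 + ((real s)\<^sup>2 - 1) / 4])" for x0 s
  have compact_level: "compact (level x0 s)" for x0 s
    by (simp add: level_def)
  have dist_same_height: "dist (vector [a, c]) (vector [b, c] :: real ^ 2) = \<bar>a - b\<bar>" for a b c :: real
    by (simp add: dist_vec_def L2_set_def sum_2 dist_real_def)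
  have "\<forall>\<^sub>F \<epsilon> in at_right (0::real). \<epsilon> > 0" by (rule eventually_at_right_less)
  moreover have "\<forall>\<^sub>F \<epsilon> in at_right (0::real). \<forall>i\<in>{..<n}. \<forall>j\<in>{..<n}. x i \<noteq> x j \<longrightarrow> \<epsilon> < \<bar>x i - x j\<bar>"
  proof (intro eventually_ball_finite ballI finite_lessThan)
    fix i j
    show "\<forall>\<^sub>F \<epsilon> in at_right (0::real). x i \<noteq> x j \<longrightarrow> \<epsilon> < \<bar>x i - x j\<bar>"
    proof (cases "x i = x j")
      case False
      then have "\<forall>\<^sub>F \<epsilon> in at_right (0::real). \<epsilon> < \<bar>x i - x j\<bar>"
        by (intro order_tendstoD(2)[OF tendsto_ident_at]) auto
      then show ?thesis by eventually_elim simp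
    qed simp
  qed
  moreover have "\<forall>\<^sub>F \<epsilon> in at_right (0::real). \<forall>i\<in>{..<n}. \<forall>j\<in>{..<n}. \<forall>a\<in>{..<n}. \<forall>b\<in>{..<n}.
      seg n x i j \<inter> seg n x a b = {} \<longrightarrow> (\<forall>p q. dist p (pt n x i) \<le> \<epsilon> \<longrightarrow> dist q (pt n x j) \<le> \<epsilon> \<longrightarrow>
      (\<forall>z\<in>closed_segment p q. \<forall>w\<in>seg n x a b. \<epsilon> < dist z w))"
  proof (intro eventually_ball_finite ballI finite_lessThan)
    fix i j a b
    show "\<forall>\<^sub>F \<epsilon> in at_right (0::real). seg n x i j \<inter> seg n x a b = {} \<longrightarrow> (\<forall>p q. dist p (pt n x i) \<le> \<epsilon> \<longrightarrow> dist q (pt n x j) \<le> \<epsilon> \<longrightarrow>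
      (\<forall>z\<in>closed_segment p q. \<forall>w\<in>seg n x a b. \<epsilon> < dist z w))"
    proof (cases "seg n x i j \<inter> seg n x a b = {}")
      case True
      show ?thesis
        using eventually_segment_away[OF compact_segment True] by eventually_elim blast
    qed simp
  qed
  moreover have "\<forall>\<^sub>F \<epsilon> in at_right (0::real). \<forall>i\<in>{..<n}. \<forall>j\<in>{..<n}. \<forall>m\<in>{..<n}. \<forall>s\<in>{..<2 * n}.
      seg n x i j \<inter> level (x m) s = {} \<longrightarrow> (\<forall>p q. dist p (pt n x i) \<le> \<epsilon> \<longrightarrow> dist q (pt n x j) \<le> \<epsilon> \<longrightarrow>
      (\<forall>z\<in>closed_segment p q. \<forall>w\<in>level (x m) s. \<epsilon> < dist z w))"
  proof (intro eventually_ball_finite ballI finite_lessThan)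
    fix i j m s
    show "\<forall>\<^sub>F \<epsilon> in at_right (0::real). seg n x i j \<inter> level (x m) s = {} \<longrightarrow> (\<forall>p q. dist p (pt n x i) \<le> \<epsilon> \<longrightarrow> dist q (pt n x j) \<le> \<epsilon> \<longrightarrow>
      (\<forall>z\<in>closed_segment p q. \<forall>w\<in>level (x m) s. \<epsilon> < dist z w))"
    proof (cases "seg n x i j \<inter> level (x m) s = {}")
      case True
      show ?thesis
        using eventually_segment_away[OF compact_level True] by eventually_elim blast
    qed simp
  qed
  ultimately have step: "\<forall>\<^sub>F \<epsilon> in at_right (0::real). \<exists>x' K. (\<forall>i<n. \<bar>x' i - x i\<bar> \<le> \<epsilon>) \<and> clustered n k' x' \<and>
      (\<forall>m. finite (K m)) \<and>
      (\<forall>i j m. i < j \<longrightarrow> j < n \<longrightarrow> adj i j \<or> k' i = k' j \<longrightarrow> m < n - 1 \<longrightarrow> seg n x' i j \<inter> convex hull K m = {}) \<and>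
      (\<forall>i j. i < j \<longrightarrow> j < n \<longrightarrow> adj i j \<or> k i = k j \<longrightarrow> \<not> (adj i j \<or> k' i = k' j) \<longrightarrow>
        (\<exists>m<n - 1. seg n x' i j \<inter> convex hull K m \<noteq> {}))"
  proof eventually_elim
    case (elim \<epsilon>)
    have \<epsilon>: "\<epsilon> > 0" by (fact elim(1))
    have gap: "\<epsilon> < \<bar>x i - x j\<bar>" if "i < n" "j < n" "x i \<noteq> x j" for i j
      using elim(2) that by simp
    define x' where "x' = (\<lambda>i. x i + \<epsilon> * real (k' i mod 2))"
    have mod2: "k' i mod 2 = 0 \<or> k' i mod 2 = 1" for i by auto
    have near: "dist (pt n x' i) (pt n x i) \<le> \<epsilon>" for i
      using mod2[of i] \<epsilon> by (auto simp: dist_pt x'_def)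
    have x'_le: "x i \<le> x' i" "x' i \<le> x i + \<epsilon>" for i
      using mod2[of i] \<epsilon> by (auto simp: x'_def)
    have far: "\<epsilon> < dist z w" if "i < n" "j < n" "a < n" "b < n" "seg n x i j \<inter> seg n x a b = {}"
      "z \<in> seg n x' i j" "w \<in> seg n x a b" for i j a b z w
      using elim(3) near that by blast
    have far_level: "\<epsilon> < dist z w" if "i < n" "j < n" "m < n" "s < 2 * n" "seg n x i j \<inter> level (x m) s = {}"
      "z \<in> seg n x' i j" "w \<in> level (x m) s" for i j m s z w
      using elim(4) near that by blast
    have clu': "clustered n k' x'"
      by (rule clustered_split[OF clu k mono \<epsilon> _ gap far]) (auto simp: x'_def)
    \<comment> \<open>Shifting the index sum \<open>i + j\<close> by the first index of the upper half of the cluster turns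
      it into the index of a vertex of the cluster other than the last one, so that \<open>n - 1\<close> obstacles
      suffice for all clusters together.\<close>
    define b where "b v = (LEAST l. k' l = 2 * v + 1)" for v
    \<comment> \<open>If the cluster of \<open>m\<close> has no upper half, \<open>b (k m)\<close>
      may be an arbitrary number; then no pair satisfies the strict inequality and
      \<open>G m\<close> is empty.\<close>
    define G where "G m = {(i, j). i < n \<and> j < n \<and> k i = k m \<and> k j = k m \<and> k' i < k' j \<and> i + j = m + b (k m)}" for m
    define K where "K m = (\<lambda>(i, j). tangent_point n (x m) \<epsilon> i j) ` (G m \<inter> {(i, j). \<not> adj i j})" for m
    have finite: "finite (K m)" for m
    proof -
      have "G m \<subseteq> {..<n} \<times> {..<n}" by (auto simp: G_def)
      then have "finite (G m)" by (rule finite_subset) simp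
      then show ?thesis by (simp add: K_def)
    qed
    have halves: "k' i = 2 * k i" "k' j = 2 * k i + 1" if "k i = k j" "k' i < k' j" for i j
      using that unfolding k by presburger+
    have avoid: "seg n x' i j \<inter> convex hull K m = {}"
      if ij: "i < j" "j < n" and adj: "adj i j \<or> k' i = k' j" and m: "m < n - 1" for i j m
    proof (cases "G m = {}")
      case True
      then show ?thesis by (simp add: K_def)
    next
      case False
      then obtain i0 j0 where G0: "(i0, j0) \<in> G m" by auto
      define s where "s = m + b (k m)"
      have i0: "i0 < n" "j0 < n" "k i0 = k m" "k j0 = k m" "k' i0 < k' j0" "i0 + j0 = s"
        using G0 by (auto simp: G_def s_def)
      have i: "i < n" and mn: "m < n" and s: "s < 2 * n" using ij m i0 by auto
      have G: "i1 < n" "j1 < n" "k i1 = k m" "k j1 = k m" "k' i1 < k' j1" "i1 + j1 = s" "i1 < j1"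
        if "(i1, j1) \<in> G m" for i1 j1
      proof -
        show "i1 < n" "j1 < n" "k i1 = k m" "k j1 = k m" "k' i1 < k' j1" "i1 + j1 = s"
          using that by (auto simp: G_def s_def)
        then show "i1 < j1" using mono[of j1 i1] by linarith
      qed
      have Kx: "x m < w $ 1" "w $ 1 < x m + \<epsilon>" if "w \<in> K m" for w
        using that tangent_point_x_bounds[OF \<epsilon>] by (auto simp del: tangent_point_nth simp: K_def)
      have Ky: "base n * real s / 2 \<le> w $ 2" "w $ 2 \<le> base n * real s / 2 + ((real s)\<^sup>2 - 1) / 4"
        if w: "w \<in> K m" for w
      proof -
        obtain i1 j1 where w1: "w = tangent_point n (x m) \<epsilon> i1 j1" "(i1, j1) \<in> G m"
          using w by (auto simp: K_def)
        then show "base n * real s / 2 \<le> w $ 2" "w $ 2 \<le> base n * real s / 2 + ((real s)\<^sup>2 - 1) / 4"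
          using tangent_point_y_bounds[of i1 j1 s] G[OF w1(2)] by (simp_all del: tangent_point_nth)
      qed
      have lo_hi: "base n * real s / 2 \<le> base n * real s / 2 + ((real s)\<^sup>2 - 1) / 4"
        using tangent_point_y_bounds[of i0 j0 s n 0 1] G[OF G0] by (simp del: tangent_point_nth)
      \<comment> \<open>The segment joins two clusters, lies in another cluster, lies in one half of
        the cluster of \<open>m\<close>, or joins its halves. In the second and third case it misses
        the open vertical strip of width \<epsilon> that contains the hull.\<close>
      consider "k i \<noteq> k j" | "k i = k j" "k i \<noteq> k m" | "k i = k j" "k i = k m" "k' i = k' j"
        | "k i = k j" "k i = k m" "k' i < k' j"
        using mono[of i j] ij by fastforce
      then show ?thesis
      proof cases
        case 1
        have "seg n x i j \<inter> level (x m) s = {}"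
        proof -
          have False if z: "z \<in> seg n x i j" "z \<in> level (x m) s" for z
          proof -
            have zl: "z $ 1 = x m" "base n * real s / 2 \<le> z $ 2"
              "z $ 2 \<le> base n * real s / 2 + ((real s)\<^sup>2 - 1) / 4"
              using z(2) unfolding level_def mem_vertical_segment[OF lo_hi] by auto
            have no: "height n l < base n * real s / 2 \<or> base n * real s / 2 + ((real s)\<^sup>2 - 1) / 4 < height n l"
              if "l < n" for l using height_outside_level[OF that s] .
            \<comment> \<open>The point of tangency of \<open>i0\<close> and \<open>j0\<close> lies
              in the band and between their heights, while no vertex height lies in the band. So the
              whole band is within the height range of the cluster, and a crossing there would be at
              a vertex height.\<close>
            have tp: "height n i0 \<le> z $ 2" "z $ 2 \<le> height n j0"
            proof -
              have between: "height n i0 \<le> tangent_point n 0 1 i0 j0 $ 2" "tangent_point n 0 1 i0 j0 $ 2 \<le> height n j0"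
                using tangent_point_y_between[of i0 j0 n 0 1] G(7)[OF G0] by (simp_all del: tangent_point_nth)
              have "tangent_point n 0 1 i0 j0 $ 2 \<le> base n * real s / 2 + ((real s)\<^sup>2 - 1) / 4"
                "base n * real s / 2 \<le> tangent_point n 0 1 i0 j0 $ 2"
                using tangent_point_y_bounds[of i0 j0 s n 0 1] G[OF G0] by (simp_all del: tangent_point_nth)
              then have "height n i0 < base n * real s / 2"
                "base n * real s / 2 + ((real s)\<^sup>2 - 1) / 4 < height n j0"
                using no[OF i0(1)] no[OF i0(2)] between by linarith+
              then show "height n i0 \<le> z $ 2" "z $ 2 \<le> height n j0" using zl by linarith+
            qed
            have "x i0 = x m" using clu i0 mn by (simp add: clustered_x_eq_iff)
            then have "\<exists>l\<in>{i, j}. z $ 2 = height n l \<and> k l = k i0"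
              using clustered_crossing_height[OF clu i ij(2) 1 _ i0(2) _ z(1) _ tp] zl(1) i0 G[OF G0] by simp
            then show False using no[OF i] no[OF ij(2)] zl by auto
          qed
          then show ?thesis by blast
        qed
        note away = far_level[OF i ij(2) mn s this]
        \<comment> \<open>The hull reaches at most \<epsilon> to the right of the level. Projecting
          horizontally onto the level therefore moves its points by at most \<epsilon>, against the
          distance in \<open>away\<close>.\<close>
        have box: "convex hull K m \<subseteq> cbox (vector [x m, base n * real s / 2])
           (vector [x m + \<epsilon>, base n * real s / 2 + ((real s)\<^sup>2 - 1) / 4])"
          using Kx Ky by (intro hull_minimal convex_box) (auto simp: mem_box_cart forall_2 less_imp_le)
        have False if z: "z \<in> seg n x' i j" "z \<in> convex hull K m" for z
        proof -
          have zb: "x m \<le> z $ 1" "z $ 1 \<le> x m + \<epsilon>" "base n * real s / 2 \<le> z $ 2"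
              "z $ 2 \<le> base n * real s / 2 + ((real s)\<^sup>2 - 1) / 4"
            using box z(2) by (auto simp: mem_box_cart forall_2)
          define w :: "real ^ 2" where "w = vector [x m, z $ 2]"
          have "w \<in> level (x m) s"
            unfolding level_def mem_vertical_segment[OF lo_hi] using zb by (simp add: w_def)
          moreover have "dist z w \<le> \<epsilon>"
          proof -
            have "z = vector [z $ 1, z $ 2]" by (simp add: vec_eq_iff forall_2)
            then have "dist z w = \<bar>z $ 1 - x m\<bar>" unfolding w_def by (metis dist_same_height)
            then show ?thesis using zb by simp
          qed
          ultimately show False using away[OF z(1)] by fastforce
        qed
        then show ?thesis by blast
      next
        case 2
        then have x: "x i = x j" "x i \<noteq> x m" using clu i ij mn by (auto simp: clustered_x_eq_iff)
        then have "\<epsilon> < \<bar>x i - x m\<bar>" using gap[OF i mn] by simp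
        then consider "x i + \<epsilon> < x m" | "x m + \<epsilon> < x i" by linarith
        then show ?thesis
        proof cases
          case 1
          show ?thesis
            by (rule closed_segment_disjoint_convex_hull[where c = "x m" and \<alpha> = 1 and \<beta> = 0])
               (use 1 x x'_le[of i] x'_le[of j] Kx in auto)
        next
          case 2
          show ?thesis
            by (rule closed_segment_disjoint_convex_hull[where c = "- x m - \<epsilon>" and \<alpha> = "- 1" and \<beta> = 0])
               (use 2 x x'_le[of i] x'_le[of j] Kx in force)+
        qed
      next
        case 3
        then have "x i = x m" "x j = x m" using clu i ij mn by (auto simp: clustered_x_eq_iff)
        then consider "x' i = x m" "x' j = x m" | "x' i = x m + \<epsilon>" "x' j = x m + \<epsilon>"
          using mod2[of i] 3(3) by (auto simp: x'_def)
        then show ?thesis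
        proof cases
          case 1
          show ?thesis
            by (rule closed_segment_disjoint_convex_hull[where c = "x m" and \<alpha> = 1 and \<beta> = 0])
               (use 1 Kx in auto)
        next
          case 2
          show ?thesis
            by (rule closed_segment_disjoint_convex_hull[where c = "- x m - \<epsilon>" and \<alpha> = "- 1" and \<beta> = 0])
               (use 2 Kx in force)+
        qed
      next
        case 4
        then have "x i = x m" "x j = x m" using clu i ij mn by (auto simp: clustered_x_eq_iff)
        then have x': "x' i = x m" "x' j = x m + \<epsilon>"
          using halves[OF 4(1,3)] by (simp_all add: x'_def)
        have adj: "adj i j" using that(3) 4(3) by simp
        let ?h = "height n j - height n i"
        \<comment> \<open>The height of the line through the moved vertices \<open>i\<close> and
          \<open>j\<close> above the point of tangency of \<open>i1\<close> and \<open>j1\<close>. A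
          constant sign of \<open>D\<close> over \<open>K m\<close> makes this line separate the
          segment from the hull.\<close>
        define D where "D i1 j1 = height n i + ?h *
           ((base n + 2 * real i1) / (2 * (base n + real (i1 + j1)))) -
           (base n * real (i1 + j1) / 2 + real i1 * real j1)" for i1 j1
        have line: "\<epsilon> * tangent_point n (x m) \<epsilon> i1 j1 $ 2 - ?h * tangent_point n (x m) \<epsilon> i1 j1 $ 1 =
            \<epsilon> * height n i - ?h * x m - \<epsilon> * D i1 j1" for i1 j1
          unfolding tangent_point_nth D_def by (simp only: algebra_simps)
        have ends: "\<epsilon> * pt n x' i $ 2 - ?h * pt n x' i $ 1 = \<epsilon> * height n i - ?h * x m"
          "\<epsilon> * pt n x' j $ 2 - ?h * pt n x' j $ 1 = \<epsilon> * height n i - ?h * x m"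
          by (simp_all add: x' algebra_simps)
        have D: "if i + j < s then D i1 j1 < 0 else D i1 j1 > 0"
          if w: "(i1, j1) \<in> G m" "\<not> adj i1 j1" for i1 j1
        proof -
          note g = G[OF w(1)]
          note t = tangent_point_line[OF g(1,2) i ij(2), folded D_def]
          \<comment> \<open>The segment touches the parabola only in its own point of tangency,
            which is absent from \<open>K m\<close> because the pair is adjacent.\<close>
          have "i1 \<noteq> i" if "i + j = s"
          proof
            assume "i1 = i"
            then have "j1 = j" using that g(6) by simp
            then show False using \<open>i1 = i\<close> adj w(2) by simp
          qed
          then show ?thesis using t g(6) by (cases "i + j" s rule: linorder_cases) auto
        qed
        show ?thesis
        proof (cases "i + j < s")
          case True
          show ?thesis
          proof (rule closed_segment_disjoint_convex_hull[where c = "\<epsilon> * height n i - ?h * x m" and \<alpha> = "- ?h" and \<beta> = \<epsilon>])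
            fix w assume "w \<in> K m"
            then obtain i1 j1 where w: "w = tangent_point n (x m) \<epsilon> i1 j1" "(i1, j1) \<in> G m" "\<not> adj i1 j1"
              by (auto simp: K_def)
            have "\<epsilon> * D i1 j1 < 0" using D[OF w(2,3)] True \<epsilon> by (simp add: mult_pos_neg)
            then show "\<epsilon> * height n i - ?h * x m < - ?h * w $ 1 + \<epsilon> * w $ 2"
              using line[of i1 j1] unfolding w(1) by linarith
          qed (use ends in linarith)+
        next
          case False
          show ?thesis
          proof (rule closed_segment_disjoint_convex_hull[where c = "- (\<epsilon> * height n i - ?h * x m)" and \<alpha> = "?h" and \<beta> = "- \<epsilon>"])
            fix w assume "w \<in> K m"
            then obtain i1 j1 where w: "w = tangent_point n (x m) \<epsilon> i1 j1" "(i1, j1) \<in> G m" "\<not> adj i1 j1"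
              by (auto simp: K_def)
            have "\<epsilon> * D i1 j1 > 0" using D[OF w(2,3)] False \<epsilon> by simp
            then show "- (\<epsilon> * height n i - ?h * x m) < ?h * w $ 1 + - \<epsilon> * w $ 2"
              using line[of i1 j1] unfolding w(1) by linarith
          qed (use ends in linarith)+
        qed
      qed
    qed
    have meet: "\<exists>m<n - 1. seg n x' i j \<inter> convex hull K m \<noteq> {}"
      if ij: "i < j" "j < n" and kij: "adj i j \<or> k i = k j" "\<not> (adj i j \<or> k' i = k' j)" for i j
    proof -
      have same: "k i = k j" "\<not> adj i j" "k' i < k' j"
        using kij mono[of i j] ij by auto
      note h = halves[OF same(1,3)]
      have b: "k' (b (k i)) = 2 * k i + 1" "b (k i) \<le> j"
        unfolding b_def using h(2) by (rule LeastI, rule Least_le)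
      have "i < b (k i)"
      proof (rule ccontr)
        assume "\<not> i < b (k i)"
        then show False using mono[of "b (k i)" i] b(1) h(1) ij by simp
      qed
      \<comment> \<open>Because \<open>i < b (k i)\<close> and \<open>b (k i) \<le> j\<close>, this
        index satisfies \<open>i \<le> m\<close> and \<open>m < j\<close>; monotonicity of
        \<open>k'\<close> places it in the same cluster.\<close>
      define m where "m = i + j - b (k i)"
      have m: "i \<le> m" "m < j" "m + b (k i) = i + j"
        using b(2) \<open>i < b (k i)\<close> by (auto simp: m_def)
      have "k' i \<le> k' m" "k' m \<le> k' j" using mono[of i m] mono[of m j] m ij by simp_all
      then have km: "k m = k i" using h unfolding k by presburger
      have "(i, j) \<in> G m" using ij same m km by (simp add: G_def)
      then have "tangent_point n (x m) \<epsilon> i j \<in> K m"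
        using same(2) by (force simp del: tangent_point_nth simp: K_def)
      then have "tangent_point n (x m) \<epsilon> i j \<in> convex hull K m" by (rule hull_inc)
      moreover have "tangent_point n (x m) \<epsilon> i j \<in> seg n x' i j"
      proof -
        have "x i = x m" "x j = x m" using clu km same m ij by (auto simp: clustered_x_eq_iff)
        then have "x' i = x m" "x' j = x m + \<epsilon>" using h by (simp_all add: x'_def)
        then show ?thesis using tangent_point_in_segment[of n "x m" \<epsilon> i j] by (simp add: pt_def)
      qed
      ultimately show ?thesis using m ij by (intro exI[of _ m]) auto
    qed
    have "\<forall>i<n. \<bar>x' i - x i\<bar> \<le> \<epsilon>" using near by (simp add: dist_pt)
    then show ?case
      using clu' finite avoid meet by (intro exI[of _ x'] exI[of _ K]) blast
  qed
  show ?thesis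
  proof (rule robust_representation_refine[OF rep _ step])
    show "adj i j \<or> k i = k j" if "adj i j \<or> k' i = k' j" for i j
      using that by (auto simp: k)
  qed (rule that)
qed

section \<open>Cliques and colours\<close>

text \<open>\<open>q\<close> encodes colour and clique in one number with quotient \<open>k\<close>.
  No vertex moves; a point is placed midway between consecutive vertices of one colour and different
  cliques. Edges between clusters meet the line only at vertex heights, edges inside a cluster span
  a constant value of \<open>q\<close>, and a non-edge inside a cluster spans a change of
  \<open>q\<close>.\<close>

lemma refine_cliques:
  fixes q :: "nat \<Rightarrow> nat"
  assumes clu: "clustered n k x"
    and k: "\<And>i. k i = q i div M"
    and mono: "\<And>i j. i \<le> j \<Longrightarrow> j < n \<Longrightarrow> q i \<le> q j"
    and adj: "\<And>i j. i < j \<Longrightarrow> j < n \<Longrightarrow> k i = k j \<Longrightarrow> adj i j \<longleftrightarrow> q i = q j"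
    and rep: "robust_representation n x (\<lambda>i j. adj i j \<or> k i = k j) Obs"
  obtains x' Obs' where "robust_representation n x' adj Obs'" "card Obs' \<le> card Obs + (n - 1)"
proof -
  define w where "w m = (vector [x m, (height n m + height n (Suc m)) / 2] :: real ^ 2)" for m
  define K where "K m = (if k m = k (Suc m) \<and> q m \<noteq> q (Suc m) then {w m} else {})" for m
  have w: "w m $ 1 = x m" "height n m < w m $ 2" "w m $ 2 < height n (Suc m)" for m
  proof -
    have "height n m < height n (Suc m)" by simp
    then show "w m $ 1 = x m" "height n m < w m $ 2" "w m $ 2 < height n (Suc m)"
      unfolding w_def by (auto simp del: height_less_iff simp: field_simps)
  qed
  have avoid: "seg n x i j \<inter> convex hull K m = {}" if ij: "i < j" "j < n" "adj i j" and m: "m < n - 1" for i j m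
  proof (cases "k m = k (Suc m) \<and> q m \<noteq> q (Suc m)")
    case True
    have mn: "m \<le> Suc m" "Suc m < n" "m < n" "i < n" using m ij by auto
    have "w m \<notin> seg n x i j"
    proof
      assume wm: "w m \<in> seg n x i j"
      show False
      proof (cases "k i = k j")
        case False
        then obtain l where l: "w m $ 2 = height n l"
          using clustered_crossing_height[OF clu mn(4) ij(2) False mn(1,2) _ wm] True w[of m] by auto
        then have "m < l" "l < Suc m" using w(2,3)[of m] by simp_all
        then show False by simp
      next
        case same: True
        then have "x i = x j" using clu mn ij by (simp add: clustered_x_eq_iff)
        then have "w m $ 1 = x i" "height n i \<le> w m $ 2" "w m $ 2 \<le> height n j"
          using wm seg_vertical[of x i j] ij by simp_all
        then have "height n i < height n (Suc m)" "height n m < height n j"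
          using w(2,3)[of m] by linarith+
        then have "i \<le> m" "Suc m \<le> j" by simp_all
        then have "q i \<le> q m" "q m \<le> q (Suc m)" "q (Suc m) \<le> q j"
          using mono[of i m] mono[of m "Suc m"] mono[of "Suc m" j] mn ij by simp_all
        moreover have "q i = q j" using adj ij same by simp
        ultimately show False using True by simp
      qed
    qed
    then show ?thesis using True by (simp add: K_def)
  next
    case False
    then show ?thesis unfolding K_def by (simp only: if_False convex_hull_empty Int_empty_right)
  qed
  have meet: "\<exists>m<n - 1. seg n x i j \<inter> convex hull K m \<noteq> {}"
    if ij: "i < j" "j < n" and na: "adj i j \<or> k i = k j" "\<not> adj i j" for i j
  proof -
    have kij: "k i = k j" and "q i \<noteq> q j" using na adj ij by auto
    have "\<exists>m. i \<le> m \<and> m < j \<and> q m \<noteq> q (Suc m)"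
    proof (rule ccontr)
      assume no: "\<not> ?thesis"
      have "q i = q l" if "i \<le> l" "l \<le> j" for l
        using that by (induction l rule: dec_induct) (use no in auto)
      then show False using \<open>q i \<noteq> q j\<close> ij by simp
    qed
    then obtain m where m: "i \<le> m" "m < j" "q m \<noteq> q (Suc m)" by blast
    have "q i \<le> q m" "q m \<le> q (Suc m)" "q (Suc m) \<le> q j"
      using mono[of i m] mono[of m "Suc m"] mono[of "Suc m" j] m ij by simp_all
    then have "k i \<le> k m" "k m \<le> k (Suc m)" "k (Suc m) \<le> k j"
      unfolding k by (simp_all add: div_le_mono)
    then have km: "k m = k i" "k (Suc m) = k i" using kij by simp_all
    then have "x i = x j" "x m = x i" using clu kij m ij by (auto simp: clustered_x_eq_iff)
    moreover have "height n i \<le> height n m" "height n (Suc m) \<le> height n j" using m by simp_all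
    then have "height n i \<le> w m $ 2" "w m $ 2 \<le> height n j" using w(2,3)[of m] by linarith+
    ultimately have "w m \<in> seg n x i j"
      using seg_vertical[of x i j "w m" n] w[of m] ij by simp
    moreover have "w m \<in> convex hull K m" using m km by (simp add: K_def)
    ultimately show ?thesis using m ij by (intro exI[of _ m]) auto
  qed
  have "\<forall>\<^sub>F \<rho> in at_right (0::real). \<rho> > 0" by (rule eventually_at_right_less)
  then have step: "\<forall>\<^sub>F \<rho> in at_right (0::real). \<exists>x' K. (\<forall>i<n. \<bar>x' i - x i\<bar> \<le> \<rho>) \<and> True \<and> (\<forall>m. finite (K m)) \<and>
      (\<forall>i j m. i < j \<longrightarrow> j < n \<longrightarrow> adj i j \<longrightarrow> m < n - 1 \<longrightarrow> seg n x' i j \<inter> convex hull K m = {}) \<and>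
      (\<forall>i j. i < j \<longrightarrow> j < n \<longrightarrow> adj i j \<or> k i = k j \<longrightarrow> \<not> adj i j \<longrightarrow>
        (\<exists>m<n - 1. seg n x' i j \<inter> convex hull K m \<noteq> {}))"
  proof eventually_elim
    case (elim \<rho>)
    moreover have "\<forall>m. finite (K m)" by (simp add: K_def)
    ultimately show ?case using avoid meet by (intro exI[of _ x] exI[of _ K]) simp
  qed
  show ?thesis
    by (rule robust_representation_refine[where Q = "\<lambda>_. True", OF rep _ step]) (use that in auto)
qed

lemma clustered_representation:
  assumes bound: "\<And>i. i < n \<Longrightarrow> c i < 2 ^ L"
    and mono: "\<And>i j. i \<le> j \<Longrightarrow> j < n \<Longrightarrow> c i \<le> c j"
    and "d \<le> L"
  shows "\<exists>x Obs. clustered n (\<lambda>i. c i div 2 ^ (L - d)) x \<and>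
    robust_representation n x (\<lambda>i j. adj i j \<or> c i div 2 ^ (L - d) = c j div 2 ^ (L - d)) Obs \<and>
    card Obs \<le> d * (n - 1)"
  using \<open>d \<le> L\<close>
proof (induction d)
  case 0
  have "clustered n (\<lambda>i. c i div 2 ^ L) (\<lambda>_. 0)"
    using bound by (auto simp: clustered_def)
  moreover have "robust_representation n (\<lambda>_. 0) (\<lambda>i j. adj i j \<or> c i div 2 ^ L = c j div 2 ^ L) {}"
    using bound by (auto simp: robust_representation_def)
  ultimately show ?case by (intro exI[of _ "\<lambda>_. 0"] exI[of _ "{}"]) simp
next
  case (Suc d)
  then obtain x Obs where x: "clustered n (\<lambda>i. c i div 2 ^ (L - d)) x"
    "robust_representation n x (\<lambda>i j. adj i j \<or> c i div 2 ^ (L - d) = c j div 2 ^ (L - d)) Obs"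
    "card Obs \<le> d * (n - 1)"
    by auto
  have "L - d = Suc (L - Suc d)" using Suc.prems by simp
  then have half: "c i div 2 ^ (L - d) = c i div 2 ^ (L - Suc d) div 2" for i
    by (simp only: power_Suc2 div_mult2_eq)
  show ?case
  proof (rule refine_split[OF x(1) half _ x(2)])
    show "c i div 2 ^ (L - Suc d) \<le> c j div 2 ^ (L - Suc d)" if "i \<le> j" "j < n" for i j
      using mono[OF that] by (rule div_le_mono)
    fix x' Obs'
    assume "clustered n (\<lambda>i. c i div 2 ^ (L - Suc d)) x'"
      "robust_representation n x' (\<lambda>i j. adj i j \<or> c i div 2 ^ (L - Suc d) = c j div 2 ^ (L - Suc d)) Obs'"
      "card Obs' \<le> card Obs + (n - 1)"
    then show ?case using x(3) by (intro exI[of _ x'] exI[of _ Obs']) simp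
  qed
qed

text \<open>After \<open>L\<close> bit rounds the clusters are the colour classes; the clique round
  accounts for the summand 1.\<close>

lemma robust_representation_of_cliques:
  fixes q :: "nat \<Rightarrow> nat"
  assumes bound: "\<And>i. i < n \<Longrightarrow> q i div M < 2 ^ L"
    and mono: "\<And>i j. i \<le> j \<Longrightarrow> j < n \<Longrightarrow> q i \<le> q j"
    and adj: "\<And>i j. i < j \<Longrightarrow> j < n \<Longrightarrow> q i div M = q j div M \<Longrightarrow> adj i j \<longleftrightarrow> q i = q j"
  shows "\<exists>x Obs. robust_representation n x adj Obs \<and> card Obs \<le> (L + 1) * (n - 1)"
proof -
  obtain x Obs where x: "clustered n (\<lambda>i. q i div M) x"
    "robust_representation n x (\<lambda>i j. adj i j \<or> q i div M = q j div M) Obs" "card Obs \<le> L * (n - 1)"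
    using clustered_representation[of n "\<lambda>i. q i div M" L L adj] bound mono by (auto simp: div_le_mono)
  obtain x' Obs' where "robust_representation n x' adj Obs'" "card Obs' \<le> card Obs + (n - 1)"
    by (rule refine_cliques[OF x(1) refl mono adj x(2)])
  then show ?thesis using x(3) by (intro exI[of _ x'] exI[of _ Obs']) simp
qed

section \<open>From subcolourings to ordered vertices\<close>

text \<open>An injective colouring has singleton classes. This ensures that the minimum defining
  \<open>subchromatic_number\<close> is attained.\<close>

lemma subcoloring_exists:
  assumes "simple_graph V E" "card V = n"
  shows "\<exists>c. subcoloring V E n c"
proof -
  have V: "finite V" "E \<subseteq> all_pairs V" using assms(1) by (auto simp: simple_graph_def)
  obtain f where f: "bij_betw f V {1..n}"
    using V(1) assms(2) by (metis bij_betw_iff_card card_atLeastAtMost diff_Suc_1 finite_atLeastAtMost)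
  have "induces_disjoint_cliques E {v \<in> V. f v = a}" for a
  proof -
    let ?A = "{v \<in> V. f v = a}"
    have single: "u = v" if "u \<in> ?A" "v \<in> ?A" for u v
      using that f by (auto simp: bij_betw_def dest: inj_onD)
    have "induced_edges E ?A = {}"
    proof -
      have False if "e \<in> E" "e \<subseteq> ?A" for e
      proof -
        have "card e = 2" using V(2) \<open>e \<in> E\<close> by (auto simp: all_pairs_def)
        then obtain u v where "e = {u, v}" "u \<noteq> v" by (meson card_2_iff)
        then show False using single \<open>e \<subseteq> ?A\<close> by blast
      qed
      then show ?thesis by (auto simp: induced_edges_def)
    qed
    moreover have "partition_on ?A ((\<lambda>v. {v}) ` ?A)"
      by (auto simp: partition_on_def disjoint_def)
    moreover have "all_pairs {v} = {}" for v :: 'a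
      by (auto simp: all_pairs_def subset_singleton_iff)
    ultimately show ?thesis unfolding induces_disjoint_cliques_def
      by (intro exI[of _ "(\<lambda>v. {v}) ` ?A"]) auto
  qed
  then show ?thesis using f by (auto simp: subcoloring_def bij_betw_def)
qed

text \<open>\<open>S v\<close> is the block containing \<open>v\<close>. Labels, unlike partitions,
  can be numbered for all colours at once.\<close>

lemma induces_disjoint_cliques_labelling:
  fixes A :: "'a set"
  assumes "induces_disjoint_cliques E A"
  shows "\<exists>S :: 'a \<Rightarrow> 'a set. \<forall>u\<in>A. \<forall>v\<in>A. u \<noteq> v \<longrightarrow> ({u, v} \<in> E \<longleftrightarrow> S u = S v)"
proof -
  obtain \<C> where \<C>: "partition_on A \<C>" "induced_edges E A = (\<Union>C\<in>\<C>. all_pairs C)"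
    using assms by (auto simp: induces_disjoint_cliques_def)
  have "\<forall>v\<in>A. \<exists>C\<in>\<C>. v \<in> C" using partition_onD1[OF \<C>(1)] by blast
  then obtain S where S: "\<And>v. v \<in> A \<Longrightarrow> S v \<in> \<C>" "\<And>v. v \<in> A \<Longrightarrow> v \<in> S v" by metis
  have S_unique: "S v = C" if "v \<in> A" "C \<in> \<C>" "v \<in> C" for v C
    using disjointD[OF partition_onD2[OF \<C>(1)], of "S v" C] S that by blast
  have iff: "{u, v} \<in> E \<longleftrightarrow> S u = S v" if uv: "u \<in> A" "v \<in> A" "u \<noteq> v" for u v
  proof
    assume "{u, v} \<in> E"
    then have "{u, v} \<in> induced_edges E A" using uv by (simp add: induced_edges_def)
    then obtain C where "C \<in> \<C>" "u \<in> C" "v \<in> C"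
      unfolding \<C>(2) by (auto simp: all_pairs_def)
    then show "S u = S v" using S_unique uv by metis
  next
    assume "S u = S v"
    then have "{u, v} \<in> all_pairs (S u)" using S(2)[OF uv(1)] S(2)[OF uv(2)] uv(3) by (simp add: all_pairs_def)
    then have "{u, v} \<in> induced_edges E A" unfolding \<C>(2) using S(1)[OF uv(1)] by blast
    then show "{u, v} \<in> E" by (simp add: induced_edges_def)
  qed
  show ?thesis by (intro exI[of _ S] ballI impI iff)
qed

lemma enumerate_by_key:
  fixes key :: "'a \<Rightarrow> nat"
  assumes "finite V" "card V = n"
  obtains w where "bij_betw w {..<n} V" "\<And>i j. i \<le> j \<Longrightarrow> j < n \<Longrightarrow> key (w i) \<le> key (w j)"
proof -
  obtain xs where xs: "set xs = V" "distinct xs"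
    using finite_distinct_list[OF assms(1)] by blast
  define ys where "ys = sort_key key xs"
  have ys: "set ys = V" "distinct ys" "length ys = n" "sorted (map key ys)"
    using xs distinct_card[OF xs(2)] assms(2) by (simp_all add: ys_def)
  have "bij_betw ((!) ys) {..<n} V"
    using ys by (intro bij_betw_nth) auto
  moreover have "key (ys ! i) \<le> key (ys ! j)" if "i \<le> j" "j < n" for i j
    using sorted_nth_mono[OF ys(4), of i j] that ys(3) by simp
  ultimately show ?thesis by (rule that)
qed

text \<open>Meeting an interior implies meeting the obstacle, the index order is immaterial as
  segments and edges are symmetric, and distinct heights make the drawing injective.\<close>

lemma obstacle_representation_if_robust:
  assumes w: "bij_betw w {..<n} V"
    and rep: "robust_representation n x (\<lambda>i j. {w i, w j} \<in> E) Obs"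
  shows "obstacle_representation V E (pt n x \<circ> the_inv_into {..<n} w) Obs"
proof -
  define idx where "idx = the_inv_into {..<n} w"
  have idx: "idx v < n" "w (idx v) = v" if "v \<in> V" for v
    using w that the_inv_into_into[of w "{..<n}" v "{..<n}"]
    unfolding idx_def bij_betw_def by (simp_all add: f_the_inv_into_f)
  have pt_inj: "pt n x i = pt n x j \<longleftrightarrow> i = j" for i j
    using pt_nth(2)[of n x i] pt_nth(2)[of n x j] by (metis height_eq_iff)
  have ordered: "{u, v} \<in> E \<longleftrightarrow> (\<forall>P\<in>Obs. seg n x (idx u) (idx v) \<inter> P = {})"
    if uv: "u \<in> V" "v \<in> V" "idx u < idx v" for u v
  proof -
    have "if {u, v} \<in> E then \<forall>P\<in>Obs. seg n x (idx u) (idx v) \<inter> P = {}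
      else \<exists>P\<in>Obs. seg n x (idx u) (idx v) \<inter> interior P \<noteq> {}"
      using rep uv idx unfolding robust_representation_def by fastforce
    then show ?thesis using interior_subset by (auto split: if_splits)
  qed
  have "{u, v} \<in> E \<longleftrightarrow> (\<forall>P\<in>Obs. seg n x (idx u) (idx v) \<inter> P = {})"
    if uv: "u \<in> V" "v \<in> V" "u \<noteq> v" for u v
  proof -
    have "idx u \<noteq> idx v" using idx uv by metis
    then consider "idx u < idx v" | "idx v < idx u" by linarith
    then show ?thesis
    proof cases
      case 2
      then show ?thesis using ordered[OF uv(2,1)] by (simp add: closed_segment_commute insert_commute)
    qed (rule ordered[OF uv(1,2)])
  qed
  moreover have "inj_on (pt n x \<circ> idx) V"
    by (rule inj_onI) (metis comp_apply idx(2) pt_inj)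
  ultimately show ?thesis
    using rep unfolding obstacle_representation_def geometric_drawing_def idx_def[symmetric]
    by (simp add: robust_representation_def)
qed

theorem theorem3:
  fixes V :: "'a set" and E :: "'a set set" and n :: nat
  assumes "n > 0" and "simple_graph V E" and "card V = n"
  shows "int (convex_obstacle_number V E)
           \<le> (int n - 1) * (\<lceil>log 2 (real (subchromatic_number V E))\<rceil> + 1)"
proof -
  have finV: "finite V" using assms(2) by (simp add: simple_graph_def)
  define s where "s = subchromatic_number V E"
  have "\<exists>c. subcoloring V E s c"
    unfolding s_def subchromatic_number_def
    using LeastI_ex[of "\<lambda>k. \<exists>c. subcoloring V E k c"] subcoloring_exists[OF assms(2,3)] by blast
  then obtain c where c: "c ` V \<subseteq> {1..s}" "\<And>a. a \<in> {1..s} \<Longrightarrow> induces_disjoint_cliques E {v \<in> V. c v = a}"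
    by (auto simp: subcoloring_def)
  have "V \<noteq> {}" using assms(1,3) by auto
  then have s1: "s \<ge> 1" using c(1) by force
  \<comment> \<open>The logarithm is nonnegative because \<open>s \<ge> 1\<close>, so
    \<open>nat\<close> does not truncate.\<close>
  define L where "L = nat \<lceil>log 2 (real s)\<rceil>"
  have "0 \<le> log 2 (real s)" using s1 by simp
  then have L: "int L = \<lceil>log 2 (real s)\<rceil>" unfolding L_def by linarith
  have "log 2 (real s) \<le> real L" unfolding L_def by linarith
  then have "real s \<le> 2 powr real L" using s1 by (simp add: log_le_iff)
  then have sL: "s \<le> 2 ^ L" by (simp add: powr_realpow)
  have "\<forall>a\<in>{1..s}. \<exists>S :: 'a \<Rightarrow> 'a set. \<forall>u\<in>{v \<in> V. c v = a}. \<forall>v\<in>{v \<in> V. c v = a}. u \<noteq> v \<longrightarrow> ({u, v} \<in> E \<longleftrightarrow> S u = S v)"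
    using induces_disjoint_cliques_labelling[OF c(2)] by (rule ballI)
  from bchoice[OF this] obtain S :: "nat \<Rightarrow> 'a \<Rightarrow> 'a set"
    where S: "\<forall>a\<in>{1..s}. \<forall>u\<in>{v \<in> V. c v = a}. \<forall>v\<in>{v \<in> V. c v = a}. u \<noteq> v \<longrightarrow>
      ({u, v} \<in> E \<longleftrightarrow> S a u = S a v)"
    by (rule exE)
  define T where "T v = S (c v) v" for v
  obtain h :: "'a set \<Rightarrow> nat" and M :: nat where h: "h ` (T ` V) = {i. i < M}" "inj_on h (T ` V)"
    using finite_imp_inj_to_nat_seg[OF finite_imageI[OF finV], of T] by blast
  have hM: "h (T v) < M" if "v \<in> V" for v using h(1) that by auto
  \<comment> \<open>A two-digit number in base \<open>M\<close> with the colour as leading digit, so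
    sorting by it groups first by colour and then by clique. Colours are shifted to start at 0
    because the quotient must be strictly below \<open>2 ^ L\<close>, while \<open>s = 2 ^ L\<close>
    is possible.\<close>
  define key where "key v = (c v - 1) * M + h (T v)" for v
  have key_div: "key v div M = c v - 1" if "v \<in> V" for v
    using hM[OF that] by (simp add: key_def)
  obtain w where w: "bij_betw w {..<n} V" "\<And>i j. i \<le> j \<Longrightarrow> j < n \<Longrightarrow> key (w i) \<le> key (w j)"
    using enumerate_by_key[OF finV assms(3), of key] by blast
  have wV: "w i \<in> V" if "i < n" for i using w(1) that by (auto simp: bij_betw_def)
  have cs: "1 \<le> c v" "c v \<le> s" if "v \<in> V" for v using c(1) that by auto
  have "\<exists>x Obs. robust_representation n x (\<lambda>i j. {w i, w j} \<in> E) Obs \<and> card Obs \<le> (L + 1) * (n - 1)"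
  proof (rule robust_representation_of_cliques[where q = "\<lambda>i. key (w i)" and M = M])
    show "key (w i) div M < 2 ^ L" if "i < n" for i
      using key_div[OF wV[OF that]] cs[OF wV[OF that]] sL by linarith
    show "key (w i) \<le> key (w j)" if "i \<le> j" "j < n" for i j using w(2) that .
    show "{w i, w j} \<in> E \<longleftrightarrow> key (w i) = key (w j)"
      if ij: "i < j" "j < n" "key (w i) div M = key (w j) div M" for i j
    proof -
      have V: "w i \<in> V" "w j \<in> V" using wV ij by auto
      have "w i \<noteq> w j" using w(1) ij by (auto simp: bij_betw_def dest: inj_onD)
      have cc: "c (w i) = c (w j)"
        using ij(3) key_div[OF V(1)] key_div[OF V(2)] cs[OF V(1)] cs[OF V(2)] by linarith
      have "{w i, w j} \<in> E \<longleftrightarrow> T (w i) = T (w j)"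
        using S[THEN bspec, of "c (w i)"] V \<open>w i \<noteq> w j\<close> cs[OF V(1)] cc by (simp add: T_def)
      also have "\<dots> \<longleftrightarrow> h (T (w i)) = h (T (w j))"
        using inj_on_eq_iff[OF h(2)] V by simp
      also have "\<dots> \<longleftrightarrow> key (w i) = key (w j)" by (simp add: key_def cc)
      finally show ?thesis .
    qed
  qed
  then obtain x Obs where x: "robust_representation n x (\<lambda>i j. {w i, w j} \<in> E) Obs"
      "card Obs \<le> (L + 1) * (n - 1)"
    by blast
  have "convex_obstacle_number V E \<le> card Obs"
    unfolding convex_obstacle_number_def
    using obstacle_representation_if_robust[OF w(1) x(1)] x(1)
    by (intro Least_le) (auto simp: robust_representation_def)
  then have "int (convex_obstacle_number V E) \<le> int ((L + 1) * (n - 1))" using x(2) by linarith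
  also have "\<dots> = (int L + 1) * (int n - 1)" using assms(1) by (simp only: of_nat_mult) (simp add: of_nat_diff)
  finally show ?thesis by (simp add: L s_def mult.commute)
qed

end
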